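(* Let $$S_{airy}^{\mathbb{C}}:=\sup\{\|D^{1/6}e^{-t\partial_x^3}u_0\|_{L^6_{t,x}(\mathbb{R}\times\mathbb{R})}: u_0\in L^2(\mathbb{R};\mathbb{C}),\ \|u_0\|_{L^2}=1\},$$ let $S_{airy}^{\mathbb{R}}$ be the same supremum taken over real-valued $u_0\in L^2(\mathbb{R};\mathbb{R})$ with $\|u_0\|_{L^2}=1$, and let $$S_{schr}^{\mathbb{C}}:=\sup\{\|e^{-it\partial_x^2}u_0\|_{L^6_{t,x}(\mathbb{R}\times\mathbb{R})}: u_0\in L^2(\mathbb{R};\mathbb{C}),\ \|u_0\|_{L^2}=1\}.$$ Then $$S_{schr}^{\mathbb{C}}\le 3^{1/6}S_{airy}^{\mathbb{C}}\qquad\text{and}\qquad S_{schr}^{\mathbb{C}}\le 2^{1/2}3^{1/6}S_{airy}^{\mathbb{R}} .$$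
   Context: Fourier transform: $\widehat{f}(\xi)=\int_{\mathbb{R}}e^{-ix\xi}f(x)\,dx$. The Airy group is $e^{-t\partial_x^3}f(x)=\frac1{2\pi}\int_{\mathbb{R}}e^{ix\xi+it\xi^3}\widehat f(\xi)\,d\xi$, the Schrödinger group is $e^{-it\partial_x^2}f(x)=\frac1{2\pi}\int_{\mathbb{R}}e^{ix\xi+it\xi^2}\widehat f(\xi)\,d\xi$, and $D^{\alpha}f(x)=\frac1{2\pi}\int_{\mathbb{R}}e^{ix\xi}|\xi|^{\alpha}\widehat f(\xi)\,d\xi$. *)

theory Defs
  imports "HOL-Analysis.Analysis"
begin

text \<open>The value is \<^term>\<open>\<infinity>\<close> when \<open>f\<close> is not \<open>p\<close>-integrable; only exponents \<open>p > 0\<close> are meant.\<close>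

definition Lp_norm :: "nat \<Rightarrow> 'a measure \<Rightarrow> ('a \<Rightarrow> 'b::real_normed_vector) \<Rightarrow> ennreal" where
  "Lp_norm p M f =
     (let I = (\<integral>\<^sup>+ x. ennreal (norm (f x) ^ p) \<partial>M)
      in if I = \<infinity> then \<infinity> else ennreal (root p (enn2real I)))"

text \<open>
  On \<open>L\<^sup>2\<close> the Fourier integrals need not converge absolutely, so the Fourier transform and its
  inverse are the usual Plancherel extensions: \<open>L\<^sup>2\<close>-limits of the integrals truncated to
  \<open>[-R, R]\<close>. The limit is determined up to null sets, and \<open>SOME\<close> picks a Borel representative.
\<close>

definition is_L2_limit :: "(real \<Rightarrow> real \<Rightarrow> complex) \<Rightarrow> (real \<Rightarrow> complex) \<Rightarrow> bool" where
  "is_L2_limit F g \<longleftrightarrow>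
     g \<in> borel_measurable lborel \<and> Lp_norm 2 lborel g < \<infinity> \<and>
     ((\<lambda>R. Lp_norm 2 lborel (\<lambda>x. F R x - g x)) \<longlongrightarrow> 0) at_top"

definition fourier_L2 :: "(real \<Rightarrow> complex) \<Rightarrow> real \<Rightarrow> complex" where
  "fourier_L2 f =
     (SOME g. is_L2_limit (\<lambda>R \<xi>. LINT x:{-R..R}|lborel. cis (- (x * \<xi>)) * f x) g)"

definition inv_fourier_L2 :: "(real \<Rightarrow> complex) \<Rightarrow> real \<Rightarrow> complex" where
  "inv_fourier_L2 g =
     (SOME f. is_L2_limit
        (\<lambda>R x. complex_of_real (1 / (2 * pi)) * (LINT \<xi>:{-R..R}|lborel. cis (x * \<xi>) * g \<xi>)) f)"

definition airy_group :: "real \<Rightarrow> (real \<Rightarrow> complex) \<Rightarrow> real \<Rightarrow> complex" where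
  "airy_group t f = inv_fourier_L2 (\<lambda>\<xi>. cis (t * \<xi> ^ 3) * fourier_L2 f \<xi>)"

definition schrodinger_group :: "real \<Rightarrow> (real \<Rightarrow> complex) \<Rightarrow> real \<Rightarrow> complex" where
  "schrodinger_group t f = inv_fourier_L2 (\<lambda>\<xi>. cis (t * \<xi> ^ 2) * fourier_L2 f \<xi>)"

definition schwartz :: "(real \<Rightarrow> complex) \<Rightarrow> bool" where
  "schwartz \<phi> \<longleftrightarrow>
     (\<exists>\<Phi> :: nat \<Rightarrow> real \<Rightarrow> complex.
        \<Phi> 0 = \<phi> \<and>
        (\<forall>n x. (\<Phi> n has_vector_derivative \<Phi> (Suc n) x) (at x)) \<and>
        (\<forall>m n. bounded (range (\<lambda>x. x ^ m *\<^sub>R \<Phi> n x))))"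

definition fourier :: "(real \<Rightarrow> complex) \<Rightarrow> real \<Rightarrow> complex" where
  "fourier \<phi> \<xi> = (LINT x|lborel. cis (- (x * \<xi>)) * \<phi> x)"

text \<open>
  For \<open>f \<in> L\<^sup>2\<close> and \<open>\<alpha> > 0\<close> the function \<open>\<bar>\<xi>\<bar>\<^sup>\<alpha> * fourier_L2 f \<xi>\<close> need not be square integrable, so
  \<open>D\<^sup>\<alpha> f\<close> is in general only the tempered distribution
  \<open>\<phi> \<mapsto> (1 / 2\<pi>) \<integral> \<bar>\<xi>\<bar>\<^sup>\<alpha> * fourier_L2 f \<xi> * fourier \<phi> (-\<xi>) d\<xi>\<close>.
  The predicate says that this distribution is the function \<open>w\<close>.
\<close>

definition is_frac_deriv :: "real \<Rightarrow> (real \<Rightarrow> complex) \<Rightarrow> (real \<Rightarrow> complex) \<Rightarrow> bool" where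
  "is_frac_deriv \<alpha> f w \<longleftrightarrow>
     w \<in> borel_measurable lborel \<and>
     (\<forall>\<phi>. schwartz \<phi> \<longrightarrow>
        has_bochner_integral lborel (\<lambda>x. w x * \<phi> x)
          (complex_of_real (1 / (2 * pi)) *
           (LINT \<xi>|lborel. complex_of_real (\<bar>\<xi>\<bar> powr \<alpha>) * fourier_L2 f \<xi> * fourier \<phi> (- \<xi>))))"

text \<open>
  Space-time \<open>L\<^sup>6\<close> norm of a time-dependent distribution, given by the predicate \<open>P t w\<close> that its
  value at time \<open>t\<close> is the function \<open>w\<close>. Each time slice is only defined up to null sets, so a
  jointly measurable representative \<open>U (t, x)\<close> is needed; any two agree almost everywhere, and the
  infimum over them is \<open>\<infinity>\<close> if there is none.
\<close>

definition L6_tx_norm :: "(real \<Rightarrow> (real \<Rightarrow> complex) \<Rightarrow> bool) \<Rightarrow> ennreal" where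
  "L6_tx_norm P =
     (INF U \<in> {U :: real \<times> real \<Rightarrow> complex.
                 U \<in> borel_measurable lborel \<and> (AE t in lborel. P t (\<lambda>x. U (t, x)))}.
        Lp_norm 6 lborel U)"

definition airy_norm :: "(real \<Rightarrow> complex) \<Rightarrow> ennreal" where
  "airy_norm u = L6_tx_norm (\<lambda>t w. is_frac_deriv (1 / 6) (airy_group t u) w)"

definition schr_norm :: "(real \<Rightarrow> complex) \<Rightarrow> ennreal" where
  "schr_norm u = L6_tx_norm (\<lambda>t w. AE x in lborel. w x = schrodinger_group t u x)"

definition S_airy_complex :: ennreal where
  "S_airy_complex =
     (SUP u \<in> {u :: real \<Rightarrow> complex. u \<in> borel_measurable lborel \<and> Lp_norm 2 lborel u = 1}.
        airy_norm u)"

definition S_airy_real :: ennreal where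
  "S_airy_real =
     (SUP u \<in> {u :: real \<Rightarrow> real. u \<in> borel_measurable lborel \<and> Lp_norm 2 lborel u = 1}.
        airy_norm (\<lambda>x. complex_of_real (u x)))"

definition S_schr_complex :: ennreal where
  "S_schr_complex =
     (SUP u \<in> {u :: real \<Rightarrow> complex. u \<in> borel_measurable lborel \<and> Lp_norm 2 lborel u = 1}.
        schr_norm u)"

end

theory Submission
  imports Defs "HOL-Probability.Characteristic_Functions" "HOL-Computational_Algebra.Polynomial"
begin

text \<open>
Modulating initial data to a high frequency \<open>N\<close> turns the Airy flow into a Schroedinger flow. If the
spectrum of the data is translated by \<open>N\<close>, the Airy phase becomes

  \<open>x (N + \<eta>) + t (N + \<eta>)\<^sup>3 = (x N + t N\<^sup>3) + (x + 3 t N\<^sup>2) \<eta> + 3 N t \<eta>\<^sup>2 + t \<eta>\<^sup>3\<close>.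

The first bracket is a unimodular factor, the coefficient of \<open>\<eta>\<close> is a Galilean change of position
\<open>y = x + 3 t N\<^sup>2\<close>, and in the new time \<open>s = 3 N t\<close> the remaining phase is \<open>s \<eta>\<^sup>2 + s \<eta>\<^sup>3 / (3 N)\<close>, whose
cubic part disappears as \<open>N\<close> grows. The weight \<open>\<bar>N + \<eta>\<bar> powr (1/6)\<close> is \<open>N powr (1/6)\<close> times a factor that
tends to 1. Its sixth power \<open>N\<close> and the Jacobian \<open>1 / (3 N)\<close> of the change of variables leave exactly
\<open>1 / 3\<close>, hence the constant \<open>3 powr (1/6)\<close> (\<open>airy_evolution_shifted\<close>, \<open>L6pow_modulated\<close>).

Fatou's lemma passes space-time norms to the limit, in the direction that the inequality asks for.
Two limits are taken. For band-limited data the modulated Airy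
evolutions converge to the Schroedinger evolution at every point of space-time
(\<open>schr_evolution_bound\<close>). For general data the spectrum is cut off to \<open>[-k n, k n]\<close>; since the phase
\<open>t \<xi>\<^sup>2\<close> is unimodular, the \<open>L\<^sup>2\<close> error of the cutoff is the same at all times, so a single fast sequence
\<open>k\<close> gives almost everywhere convergence at every time and with it a jointly measurable
representative of the Schroedinger solution (\<open>schr_norm_le\<close>).

For the comparison with real data, a band-limited datum is split into real and imaginary part. The
Airy flow commutes with complex conjugation, because its symbol satisfies \<open>m (-\<xi>) = cnj (m \<xi>)\<close>, so it
acts on the two parts separately. Each part obeys the real bound, and
\<open>(a + b)\<^sup>3 \<le> 4 (a\<^sup>3 + b\<^sup>3)\<close> applied to the squares of the parts costs the factor \<open>8\<close>, the sixth power of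
\<open>2 powr (1/2)\<close> (\<open>airy_complex_bound_by_real\<close>).

The analytic input is a part of Plancherel's theorem. The bound
\<open>\<parallel>fourier f\<parallel>\<^sup>2 \<le> 2 pi \<parallel>f\<parallel>\<^sup>2\<close> (\<open>fourier_L2_bound\<close>) makes the truncated integrals converge, and
an inversion formula identifies the transform of band-limited data (\<open>fourier_L2_inv_fourier\<close>). This
formula, as well as the uniqueness of the function that represents a fractional derivative, is checked by integrating
against Gaussians, which determine a function almost everywhere
(\<open>AE_zero_if_gaussian_integrals_zero\<close>).
\<close>

section \<open>Gaussians and the Fourier integral\<close>

lemma integrable_gaussian:
  fixes b c :: real
  assumes "c > 0"
  shows "integrable lborel (\<lambda>x. exp (- c * (x - b)\<^sup>2))"
proof -
  define \<sigma> where "\<sigma> = 1 / sqrt (2 * c)"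
  have s2: "\<sigma>\<^sup>2 = 1 / (2 * c)" using assms by (simp add: \<sigma>_def power_divide)
  have "integrable lborel (\<lambda>x. sqrt (2 * pi * \<sigma>\<^sup>2) * normal_density b \<sigma> x)"
    by (intro integrable_mult_right) (use assms in \<open>simp add: \<sigma>_def\<close>)
  moreover have "sqrt (2 * pi * \<sigma>\<^sup>2) * normal_density b \<sigma> x = exp (- c * (x - b)\<^sup>2)" for x
    using assms by (simp add: normal_density_def s2 field_simps)
  ultimately show ?thesis by simp
qed

lemma integrable_complex_gaussian:
  fixes b c :: real
  assumes "c > 0"
  shows "integrable lborel (\<lambda>x. complex_of_real (exp (- c * (x - b)\<^sup>2)))"
  using integrable_gaussian[OF assms] by (rule integrable_of_real)

lemma norm_cis_mult [simp]: "norm (cis a * z) = norm z"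
  by (simp add: norm_mult)

lemma borel_measurable_cis [measurable (raw)]:
  "f \<in> borel_measurable M \<Longrightarrow> (\<lambda>x. cis (f x)) \<in> borel_measurable M"
  unfolding cis_conv_exp by measurable

lemma borel_measurable_cnj [measurable (raw)]:
  assumes "f \<in> borel_measurable M"
  shows "(\<lambda>x. cnj (f x)) \<in> borel_measurable M"
  using assms by (rule measurable_compose) (intro borel_measurable_continuous_onI continuous_intros)

lemma integrable_cis_mult:
  assumes "integrable lborel f" "g \<in> borel_measurable lborel"
  shows "integrable lborel (\<lambda>x. cis (g x) * f x)"
  using assms(1)
  by (rule Bochner_Integration.integrable_bound) (use assms in auto)

text \<open>
A rescaling of the fact that the standard normal distribution has characteristic function
\<open>exp (- t\<^sup>2 / 2)\<close>.
\<close>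

lemma gaussian_oscillatory_integral:
  fixes c s :: real
  assumes c: "c > 0"
  shows "(LINT x|lborel. cis (s * x) * complex_of_real (exp (- c * x\<^sup>2))) =
           complex_of_real (sqrt (pi / c) * exp (- s\<^sup>2 / (4 * c)))"
proof -
  \<comment> \<open>the scale at which the standard normal density becomes a multiple of \<open>exp (- c * x\<^sup>2)\<close>\<close>
  define k where "k = sqrt (2 * c)"
  have k: "k > 0" "k\<^sup>2 = 2 * c" using c by (auto simp: k_def)
  let ?G = "\<lambda>x. std_normal_density x *\<^sub>R iexp (s / k * x)"
  have "complex_of_real (exp (- ((s / k)\<^sup>2) / 2)) = char std_normal_distribution (s / k)"
    by (simp add: char_std_normal_distribution)
  also have "\<dots> = (LINT x|lborel. ?G x)"
    unfolding char_def by (subst integral_density) auto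
  also have "\<dots> = k *\<^sub>R (LINT x|lborel. ?G (0 + k * x))"
    using k by (subst lborel_integral_real_affine[where c=k and t=0]) auto
  also have "(\<lambda>x. ?G (0 + k * x)) = (\<lambda>x. complex_of_real (1 / sqrt (2 * pi)) * (cis (s * x) * complex_of_real (exp (- c * x\<^sup>2))))"
    using k by (auto simp: fun_eq_iff std_normal_density_def cis_conv_exp power_mult_distrib scaleR_conv_of_real exp_of_real algebra_simps)
  finally have *: "complex_of_real (exp (- ((s / k)\<^sup>2) / 2)) = complex_of_real (k / sqrt (2 * pi)) *
      (LINT x|lborel. cis (s * x) * complex_of_real (exp (- c * x\<^sup>2)))"
    by (simp add: scaleR_conv_of_real)
  have "sqrt (pi / c) * (k / sqrt (2 * pi)) = 1"
    using c by (simp add: k_def real_sqrt_divide real_sqrt_mult)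
  then have "complex_of_real (sqrt (pi / c)) * complex_of_real (k / sqrt (2 * pi)) = 1"
    by (metis of_real_1 of_real_mult)
  then have "(LINT x|lborel. cis (s * x) * complex_of_real (exp (- c * x\<^sup>2))) =
     complex_of_real (sqrt (pi / c)) * (complex_of_real (k / sqrt (2 * pi)) *
      (LINT x|lborel. cis (s * x) * complex_of_real (exp (- c * x\<^sup>2))))"
    by (simp only: mult.assoc[symmetric] mult_1)
  also have "\<dots> = complex_of_real (sqrt (pi / c) * exp (- ((s / k)\<^sup>2) / 2))"
    unfolding *[symmetric] by simp
  also have "- ((s / k)\<^sup>2) / 2 = - s\<^sup>2 / (4 * c)"
    using k by (simp add: power_divide)
  finally show ?thesis .
qed

lemma fourier_modulated_gaussian:
  fixes b c :: real
  assumes "c > 0"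
  shows "fourier (\<lambda>x. cis (b * x) * complex_of_real (exp (- c * x\<^sup>2))) \<xi> =
           complex_of_real (sqrt (pi / c) * exp (- (\<xi> - b)\<^sup>2 / (4 * c)))"
proof -
  have "cis (- (x * \<xi>)) * (cis (b * x) * z) = cis ((b - \<xi>) * x) * z" for x z
    unfolding mult.assoc[symmetric] cis_mult by (simp add: algebra_simps)
  then show ?thesis
    unfolding fourier_def
    using gaussian_oscillatory_integral[OF assms, of "b - \<xi>"] by (simp only: power2_commute[of b \<xi>])
qed

lemma fourier_shifted_gaussian:
  fixes b c :: real
  assumes "c > 0"
  shows "fourier (\<lambda>x. complex_of_real (exp (- c * (x - b)\<^sup>2))) \<xi> =
           complex_of_real (sqrt (pi / c)) * (cis (- b * \<xi>) * complex_of_real (exp (- (1 / (4 * c)) * \<xi>\<^sup>2)))"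
proof -
  have "fourier (\<lambda>x. complex_of_real (exp (- c * (x - b)\<^sup>2))) \<xi> =
     (LINT x|lborel. cis (- ((b + 1 * x) * \<xi>)) * complex_of_real (exp (- c * ((b + 1 * x) - b)\<^sup>2)))"
    unfolding fourier_def
    by (subst lborel_integral_real_affine[where c=1 and t=b]) auto
  also have "\<dots> = (LINT x|lborel. cis (- b * \<xi>) * (cis (- \<xi> * x) * complex_of_real (exp (- c * x\<^sup>2))))"
    unfolding mult.assoc[symmetric] cis_mult by (simp add: algebra_simps)
  also have "\<dots> = cis (- b * \<xi>) * (LINT x|lborel. (cis (- \<xi> * x) * complex_of_real (exp (- c * x\<^sup>2))))"
    by (rule integral_mult_right_zero)
  also have "(LINT x|lborel. (cis (- \<xi> * x) * complex_of_real (exp (- c * x\<^sup>2)))) =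
     complex_of_real (sqrt (pi / c) * exp (- (- \<xi>)\<^sup>2 / (4 * c)))"
    by (rule gaussian_oscillatory_integral[OF assms])
  finally show ?thesis by simp
qed

lemma borel_measurable_fourier [measurable]:
  assumes [measurable]: "f \<in> borel_measurable borel"
  shows "fourier f \<in> borel_measurable borel"
  unfolding fourier_def by measurable

lemma norm_fourier_le:
  "norm (fourier f \<xi>) \<le> (LINT x|lborel. norm (f x))"
proof -
  have "norm (fourier f \<xi>) \<le> (LINT x|lborel. norm (cis (- (x * \<xi>)) * f x))"
    unfolding fourier_def by (rule integral_norm_bound)
  then show ?thesis by simp
qed

lemma integrable_bounded_mult:
  fixes f g :: "real \<Rightarrow> complex"
  assumes "integrable lborel f" "g \<in> borel_measurable lborel" "\<And>x. norm (g x) \<le> B"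
  shows "integrable lborel (\<lambda>x. g x * f x)"
proof (rule Bochner_Integration.integrable_bound[of _ "\<lambda>x. B * norm (f x)"])
  show "integrable lborel (\<lambda>x. B * norm (f x))" using assms(1) by auto
  show "(\<lambda>x. g x * f x) \<in> borel_measurable lborel" using assms by auto
  show "AE x in lborel. norm (g x * f x) \<le> norm (B * norm (f x))"
  proof (intro AE_I2)
    fix x
    have "norm (g x) * norm (f x) \<le> B * norm (f x)"
      using assms(3) by (rule mult_right_mono) simp
    then show "norm (g x * f x) \<le> norm (B * norm (f x))"
      by (simp add: norm_mult)
  qed
qed

lemma integrable_fourier_mult:
  assumes "integrable lborel f" "integrable lborel g"
  shows "integrable lborel (\<lambda>x. fourier f x * g x)"
  using assms(2) by (rule integrable_bounded_mult[OF _ _ norm_fourier_le]) (use assms in measurable)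

text \<open>
Both sides are the double integral of \<open>cis (- x \<xi>) * f x * g \<xi>\<close>. Every later identity about the Fourier
transform comes from moving it across a pairing in this way onto an explicit Gaussian.
\<close>

lemma fourier_duality:
  assumes f: "integrable lborel f" and g: "integrable lborel g"
  shows "(LINT \<xi>|lborel. fourier f \<xi> * g \<xi>) = (LINT x|lborel. f x * fourier g x)"
proof -
  have [measurable]: "f \<in> borel_measurable borel" "g \<in> borel_measurable borel"
    using f g by auto
  let ?k = "\<lambda>x \<xi>. cis (- (x * \<xi>)) * (f x * g \<xi>)"
  have int: "integrable (lborel \<Otimes>\<^sub>M lborel) (case_prod ?k)"
  proof (rule lborel_pair.Fubini_integrable)
    show "case_prod ?k \<in> borel_measurable (lborel \<Otimes>\<^sub>M lborel)" by measurable
    have "(LINT y|lborel. norm (case (x, y) of (x, \<xi>) \<Rightarrow> ?k x \<xi>)) = norm (f x) * (LINT y|lborel. norm (g y))" for x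
      by (simp add: norm_mult)
    then show "integrable lborel (\<lambda>x. LINT y|lborel. norm (case (x, y) of (x, \<xi>) \<Rightarrow> ?k x \<xi>))"
      using f by simp
    show "AE x in lborel. integrable lborel (\<lambda>y. case (x, y) of (x, \<xi>) \<Rightarrow> ?k x \<xi>)"
      using g by (intro AE_I2) (auto intro!: integrable_cis_mult)
  qed
  have "(LINT \<xi>|lborel. fourier f \<xi> * g \<xi>) = (LINT \<xi>|lborel. LINT x|lborel. ?k x \<xi>)"
    unfolding fourier_def by (simp flip: integral_mult_left_zero add: mult.assoc)
  also have "\<dots> = (LINT x|lborel. LINT \<xi>|lborel. ?k x \<xi>)"
    by (rule lborel_pair.Fubini_integral[OF int])
  also have "\<dots> = (LINT x|lborel. f x * fourier g x)"
    unfolding fourier_def by (simp flip: integral_mult_right_zero add: mult_ac)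
  finally show ?thesis .
qed

section \<open>The mean square bound for the Fourier integral\<close>

text \<open>
The squared \<open>L\<^sup>2\<close> norm, with values in the extended reals so that it is meaningful for every measurable
function.
\<close>

definition L2sq :: "(real \<Rightarrow> complex) \<Rightarrow> ennreal" where
  "L2sq f = (\<integral>\<^sup>+ x. ennreal (norm (f x) ^ 2) \<partial>lborel)"

text \<open>
The kernel is \<open>2 pi\<close> times a normal density of variance \<open>2 c\<close>, in either of its variables.
\<close>

lemma nn_integral_heat_kernel:
  fixes c :: real
  assumes c: "c > 0"
  shows "(\<integral>\<^sup>+ y. ennreal (sqrt (pi / c) * exp (- (y - x)\<^sup>2 / (4 * c))) \<partial>lborel) = ennreal (2 * pi)"
    and "(\<integral>\<^sup>+ x. ennreal (sqrt (pi / c) * exp (- (y - x)\<^sup>2 / (4 * c))) \<partial>lborel) = ennreal (2 * pi)"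
proof -
  have eq: "sqrt (pi / c) * exp (- (y - x)\<^sup>2 / (4 * c)) = 2 * pi * normal_density x (sqrt (2 * c)) y" for x y :: real
  proof -
    have "sqrt (pi / c) = sqrt ((2 * pi)\<^sup>2 / (4 * pi * c))"
      using c by (simp add: power2_eq_square)
    also have "\<dots> = 2 * pi * (1 / sqrt (4 * pi * c))"
      by (simp only: real_sqrt_divide real_sqrt_abs) simp
    finally show ?thesis using c by (simp add: normal_density_def mult_ac)
  qed
  have 1: "(\<integral>\<^sup>+ y. ennreal (sqrt (pi / c) * exp (- (y - x)\<^sup>2 / (4 * c))) \<partial>lborel) = ennreal (2 * pi)" for x
    unfolding eq using c by (subst nn_integral_eq_integral) auto
  show "(\<integral>\<^sup>+ y. ennreal (sqrt (pi / c) * exp (- (y - x)\<^sup>2 / (4 * c))) \<partial>lborel) = ennreal (2 * pi)"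
    by (rule 1)
  have "(\<integral>\<^sup>+ x. ennreal (sqrt (pi / c) * exp (- (y - x)\<^sup>2 / (4 * c))) \<partial>lborel)
      = (\<integral>\<^sup>+ x. ennreal (sqrt (pi / c) * exp (- (x - y)\<^sup>2 / (4 * c))) \<partial>lborel)"
    by (simp add: power2_commute)
  then show "(\<integral>\<^sup>+ x. ennreal (sqrt (pi / c) * exp (- (y - x)\<^sup>2 / (4 * c))) \<partial>lborel) = ennreal (2 * pi)"
    using 1 by simp
qed

text \<open>
The weight makes Fubini available. Two applications of duality turn the left side into
\<open>\<integral>\<integral> f x * cnj (f y) * K (y - x)\<close>, where \<open>K\<close> is the Fourier transform of the weight. Since \<open>K\<close> is positive
with total mass \<open>2 pi\<close>, the bound \<open>\<bar>f x f y\<bar> \<le> (\<bar>f x\<bar>\<^sup>2 + \<bar>f y\<bar>\<^sup>2) / 2\<close> gives a constant that does not depend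
on \<open>c\<close>.
\<close>

lemma gaussian_weighted_fourier_bound:
  fixes c :: real
  assumes f: "integrable lborel f" and c: "c > 0"
  shows "(\<integral>\<^sup>+ \<xi>. ennreal (norm (fourier f \<xi>) ^ 2 * exp (- c * \<xi>\<^sup>2)) \<partial>lborel) \<le> ennreal (2 * pi) * L2sq f"
proof -
  have [measurable]: "f \<in> borel_measurable borel"
    using f by auto
  define K where "K z = sqrt (pi / c) * exp (- z\<^sup>2 / (4 * c))" for z :: real
  have K0: "K z \<ge> 0" for z using c by (simp add: K_def)
  have [measurable]: "K \<in> borel_measurable borel" unfolding K_def by measurable
  note K1 = nn_integral_heat_kernel(1)[OF c, folded K_def]
  note K2 = nn_integral_heat_kernel(2)[OF c, folded K_def]
  define \<gamma> where "\<gamma> \<xi> = complex_of_real (exp (- c * \<xi>\<^sup>2))" for \<xi>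
  have \<gamma>: "integrable lborel \<gamma>"
    using integrable_complex_gaussian[OF c, of 0] by (simp add: \<gamma>_def[abs_def])
  have [measurable]: "\<gamma> \<in> borel_measurable borel" using \<gamma> by auto
  define \<phi> where "\<phi> \<xi> = cnj (fourier f \<xi>) * \<gamma> \<xi>" for \<xi>
  have \<phi>: "integrable lborel \<phi>"
    unfolding \<phi>_def by (rule integrable_bounded_mult[OF \<gamma>, where B="LINT x|lborel. norm (f x)"])
       (auto simp: norm_fourier_le)
  have pw: "fourier f \<xi> * \<phi> \<xi> = complex_of_real (norm (fourier f \<xi>) ^ 2 * exp (- c * \<xi>\<^sup>2))" for \<xi>
    unfolding \<phi>_def \<gamma>_def mult.assoc[symmetric] complex_norm_square[symmetric] by simp
  have F\<phi>: "fourier \<phi> x = cnj (LINT y|lborel. f y * complex_of_real (K (y - x)))" for x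
  proof -
    have "fourier \<phi> x = (LINT \<xi>|lborel. cnj (fourier f \<xi> * (cis (x * \<xi>) * \<gamma> \<xi>)))"
      unfolding fourier_def[of \<phi>] \<phi>_def by (rule Bochner_Integration.integral_cong) (auto simp: cis_cnj \<gamma>_def mult_ac)
    also have "\<dots> = cnj (LINT \<xi>|lborel. fourier f \<xi> * (cis (x * \<xi>) * \<gamma> \<xi>))"
      by (rule Bochner_Integration.integral_cnj)
    also have "(LINT \<xi>|lborel. fourier f \<xi> * (cis (x * \<xi>) * \<gamma> \<xi>)) = (LINT y|lborel. f y * fourier (\<lambda>\<xi>. cis (x * \<xi>) * \<gamma> \<xi>) y)"
      by (intro fourier_duality f integrable_cis_mult \<gamma>) measurable
    finally show ?thesis
      unfolding \<gamma>_def fourier_modulated_gaussian[OF c] K_def .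
  qed
  have intr: "integrable lborel (\<lambda>\<xi>. norm (fourier f \<xi>) ^ 2 * exp (- c * \<xi>\<^sup>2))"
    using integrable_fourier_mult[OF f \<phi>] unfolding pw by (simp only: complex_of_real_integrable_eq)
  have "(\<integral>\<^sup>+ \<xi>. ennreal (norm (fourier f \<xi>) ^ 2 * exp (- c * \<xi>\<^sup>2)) \<partial>lborel) =
      ennreal (LINT \<xi>|lborel. norm (fourier f \<xi>) ^ 2 * exp (- c * \<xi>\<^sup>2))"
    by (rule nn_integral_eq_integral[OF intr]) auto
  also have "\<dots> \<le> ennreal (norm (LINT \<xi>|lborel. fourier f \<xi> * \<phi> \<xi>))"
    unfolding pw integral_complex_of_real by (intro ennreal_leI) simp
  also have "(LINT \<xi>|lborel. fourier f \<xi> * \<phi> \<xi>) = (LINT x|lborel. f x * fourier \<phi> x)"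
    by (rule fourier_duality[OF f \<phi>])
  also have "ennreal (norm \<dots>) \<le> (\<integral>\<^sup>+ x. norm (f x * fourier \<phi> x) \<partial>lborel)"
    using integrable_fourier_mult[OF \<phi> f] by (intro integral_norm_bound_ennreal) (simp add: mult.commute)
  also have "\<dots> \<le> (\<integral>\<^sup>+ x. \<integral>\<^sup>+ y. ennreal (norm (f x)) * ennreal (norm (f y) * K (y - x)) \<partial>lborel \<partial>lborel)"
  proof (rule nn_integral_mono)
    fix x
    have "ennreal (norm (f x * fourier \<phi> x)) = ennreal (norm (f x)) * ennreal (norm (LINT y|lborel. f y * complex_of_real (K (y - x))))"
      by (simp add: norm_mult ennreal_mult F\<phi>)
    also have "\<dots> \<le> ennreal (norm (f x)) * (\<integral>\<^sup>+ y. norm (f y * complex_of_real (K (y - x))) \<partial>lborel)"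
      by (intro mult_left_mono) (metis integral_norm_bound_ennreal ennreal_0 norm_zero not_integrable_integral_eq zero_le, simp)
    also have "\<dots> = (\<integral>\<^sup>+ y. ennreal (norm (f x)) * ennreal (norm (f y) * K (y - x)) \<partial>lborel)"
      using K0 by (subst nn_integral_cmult[symmetric]) (auto simp: norm_mult)
    finally show "ennreal (norm (f x * fourier \<phi> x)) \<le> (\<integral>\<^sup>+ y. ennreal (norm (f x)) * ennreal (norm (f y) * K (y - x)) \<partial>lborel)" .
  qed
  also have "\<dots> \<le> (\<integral>\<^sup>+ x. \<integral>\<^sup>+ y. ennreal (norm (f x) ^ 2 / 2) * ennreal (K (y - x)) + ennreal (norm (f y) ^ 2 / 2) * ennreal (K (y - x)) \<partial>lborel \<partial>lborel)"
  proof (intro nn_integral_mono)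
    fix x y
    have "norm (f x) * norm (f y) \<le> norm (f x) ^ 2 / 2 + norm (f y) ^ 2 / 2"
      using sum_squares_bound[of "norm (f x)" "norm (f y)"] by simp
    then have "norm (f x) * (norm (f y) * K (y - x)) \<le> (norm (f x) ^ 2 / 2 + norm (f y) ^ 2 / 2) * K (y - x)"
      using K0 unfolding mult.assoc[symmetric] by (intro mult_right_mono) auto
    then show "ennreal (norm (f x)) * ennreal (norm (f y) * K (y - x)) \<le> ennreal (norm (f x) ^ 2 / 2) * ennreal (K (y - x)) + ennreal (norm (f y) ^ 2 / 2) * ennreal (K (y - x))"
      using K0 by (simp flip: ennreal_mult ennreal_plus add: distrib_right)
  qed
  also have "\<dots> = (\<integral>\<^sup>+ x. \<integral>\<^sup>+ y. ennreal (norm (f x) ^ 2 / 2) * ennreal (K (y - x)) \<partial>lborel \<partial>lborel)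
      + (\<integral>\<^sup>+ x. \<integral>\<^sup>+ y. ennreal (norm (f y) ^ 2 / 2) * ennreal (K (y - x)) \<partial>lborel \<partial>lborel)"
    by (simp add: nn_integral_add)
  also have "(\<integral>\<^sup>+ x. \<integral>\<^sup>+ y. ennreal (norm (f y) ^ 2 / 2) * ennreal (K (y - x)) \<partial>lborel \<partial>lborel)
      = (\<integral>\<^sup>+ y. \<integral>\<^sup>+ x. ennreal (norm (f y) ^ 2 / 2) * ennreal (K (y - x)) \<partial>lborel \<partial>lborel)"
    by (rule lborel_pair.Fubini'[symmetric]) measurable
  also have "\<dots> = (\<integral>\<^sup>+ y. ennreal (norm (f y) ^ 2 / 2) * ennreal (2 * pi) \<partial>lborel)"
    by (simp add: nn_integral_cmult K2)
  also have "(\<integral>\<^sup>+ x. \<integral>\<^sup>+ y. ennreal (norm (f x) ^ 2 / 2) * ennreal (K (y - x)) \<partial>lborel \<partial>lborel)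
      = (\<integral>\<^sup>+ y. ennreal (norm (f y) ^ 2 / 2) * ennreal (2 * pi) \<partial>lborel)"
    by (simp add: nn_integral_cmult K1)
  also have "(\<integral>\<^sup>+ y. ennreal (norm (f y) ^ 2 / 2) * ennreal (2 * pi) \<partial>lborel) + (\<integral>\<^sup>+ y. ennreal (norm (f y) ^ 2 / 2) * ennreal (2 * pi) \<partial>lborel)
      = (\<integral>\<^sup>+ y. ennreal (2 * pi) * ennreal (norm (f y) ^ 2) \<partial>lborel)"
    by (subst nn_integral_add[symmetric]) (auto simp flip: ennreal_mult ennreal_plus intro!: nn_integral_cong)
  also have "\<dots> = ennreal (2 * pi) * L2sq f"
    unfolding L2sq_def by (rule nn_integral_cmult) simp
  finally show ?thesis .
qed

text \<open>
The weights \<open>exp (- c \<xi>\<^sup>2)\<close> tend to 1 as \<open>c\<close> tends to 0.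
\<close>

lemma fourier_L2_bound:
  assumes f: "integrable lborel f"
  shows "L2sq (fourier f) \<le> ennreal (2 * pi) * L2sq f"
proof -
  have [measurable]: "f \<in> borel_measurable borel"
    using f by auto
  let ?u = "\<lambda>n \<xi>. ennreal (norm (fourier f \<xi>) ^ 2 * exp (- (1 / real (Suc n)) * \<xi>\<^sup>2))"
  have lim: "(\<lambda>n. ?u n \<xi>) \<longlonglongrightarrow> ennreal (norm (fourier f \<xi>) ^ 2)" for \<xi>
  proof -
    have "(\<lambda>n. norm (fourier f \<xi>) ^ 2 * exp (- (1 / real (Suc n)) * \<xi>\<^sup>2)) \<longlonglongrightarrow> norm (fourier f \<xi>) ^ 2 * exp (- 0 * \<xi>\<^sup>2)"
      by (intro tendsto_intros LIMSEQ_Suc lim_1_over_n)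
    then show ?thesis by (intro tendsto_ennrealI) simp
  qed
  have "L2sq (fourier f) = (\<integral>\<^sup>+ \<xi>. liminf (\<lambda>n. ?u n \<xi>) \<partial>lborel)"
    unfolding L2sq_def by (intro nn_integral_cong lim_imp_Liminf[symmetric] lim) simp
  also have "\<dots> \<le> liminf (\<lambda>n. \<integral>\<^sup>+ \<xi>. ?u n \<xi> \<partial>lborel)"
    by (rule nn_integral_liminf) measurable
  also have "\<dots> \<le> liminf (\<lambda>n. ennreal (2 * pi) * L2sq f)"
    by (intro Liminf_mono always_eventually allI gaussian_weighted_fourier_bound f) simp
  also have "\<dots> = ennreal (2 * pi) * L2sq f" by (simp add: Liminf_const)
  finally show ?thesis .
qed

section \<open>Gaussian averages determine a function\<close>

lemma integral_zero_if_interval_integrals_zero: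
  fixes \<psi> :: "real \<Rightarrow> complex"
  assumes \<psi>: "integrable lborel \<psi>"
    and zero: "\<And>a b. (LINT x:{a<..<b}|lborel. \<psi> x) = 0"
  shows "integral\<^sup>L lborel \<psi> = 0"
proof -
  have [measurable]: "\<psi> \<in> borel_measurable borel" using \<psi> by auto
  have "(\<lambda>n. LINT x:{- real n<..<real n}|lborel. \<psi> x) \<longlonglongrightarrow> integral\<^sup>L lborel \<psi>"
    unfolding set_lebesgue_integral_def
  proof (rule integral_dominated_convergence[where w="\<lambda>x. norm (\<psi> x)"])
    show "AE x in lborel. (\<lambda>n. indicat_real {- real n<..<real n} x *\<^sub>R \<psi> x) \<longlonglongrightarrow> \<psi> x"
    proof (intro AE_I2)
      fix x :: real
      obtain N where N: "\<bar>x\<bar> < real N" using reals_Archimedean2 by blast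
      have "\<forall>\<^sub>F n in sequentially. indicat_real {- real n<..<real n} x *\<^sub>R \<psi> x = \<psi> x"
        using eventually_ge_at_top[of N] by eventually_elim (use N in \<open>auto simp: indicator_def\<close>)
      then show "(\<lambda>n. indicat_real {- real n<..<real n} x *\<^sub>R \<psi> x) \<longlonglongrightarrow> \<psi> x"
        by (rule tendsto_eventually)
    qed
  qed (use \<psi> in \<open>auto simp: indicator_def\<close>)
  then show ?thesis unfolding zero by (simp add: LIMSEQ_const_iff)
qed

text \<open>
Open intervals form a generator of the Borel sets that is closed under intersection, and the sets
over which \<open>\<psi>\<close> integrates to 0 form a Dynkin system.
\<close>

lemma AE_zero_if_interval_integrals_zero:
  fixes \<psi> :: "real \<Rightarrow> complex"
  assumes \<psi>: "integrable lborel \<psi>"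
    and zero: "\<And>a b. (LINT x:{a<..<b}|lborel. \<psi> x) = 0"
  shows "AE x in lborel. \<psi> x = 0"
proof -
  have [measurable]: "\<psi> \<in> borel_measurable borel" using \<psi> by auto
  have si: "set_integrable lborel A \<psi>" if "A \<in> sets borel" for A
    unfolding set_integrable_def using that \<psi> by (intro integrable_mult_indicator) auto
  let ?G = "range (\<lambda>(a, b). {a<..<b::real})"
  have int_stable: "Int_stable ?G"
  proof (rule Int_stableI)
    fix A B assume "A \<in> ?G" "B \<in> ?G"
    then obtain a b a' b' where "A = {a<..<b}" "B = {a'<..<b'}" by auto
    then have "A \<inter> B = {max a a'<..<min b b'}" by auto
    then show "A \<inter> B \<in> ?G" by (intro image_eqI[of _ _ "(max a a', min b b')"]) auto
  qed
  have pow: "?G \<subseteq> Pow UNIV" by simp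
  have sets: "sigma_sets UNIV ?G = sets borel"
    unfolding borel_eq_box box_real by simp
  have "(LINT x:A|lborel. \<psi> x) = 0" if "A \<in> sigma_sets UNIV ?G" for A
    using int_stable pow that
  proof (induction rule: sigma_sets_induct_disjoint)
    case (basic A)
    then show ?case using zero by auto
  next
    case empty
    then show ?case by (simp add: set_lebesgue_integral_def)
  next
    case (compl A)
    then have A: "A \<in> sets borel" by (simp add: sets)
    have "(LINT x:A \<union> (UNIV - A)|lborel. \<psi> x) = (LINT x:A|lborel. \<psi> x) + (LINT x:UNIV - A|lborel. \<psi> x)"
      by (rule set_integral_Un) (use A in \<open>auto intro!: si\<close>)
    moreover have "(LINT x:A \<union> (UNIV - A)|lborel. \<psi> x) = 0"
      using integral_zero_if_interval_integrals_zero[OF assms] by (simp add: set_lebesgue_integral_def)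
    ultimately show ?case using compl by simp
  next
    case (union A)
    then have A: "\<And>i. A i \<in> sets borel" by (auto simp: sets)
    then have "(\<Union>i. A i) \<in> sets borel" by blast
    then have "(LINT x:(\<Union>i. A i)|lborel. \<psi> x) = (\<Sum>i. LINT x:A i|lborel. \<psi> x)"
      using A union by (intro lebesgue_integral_countable_add si) (auto simp: disjoint_family_on_def)
    then show ?case using union by simp
  qed
  then have "AE x in lborel. \<psi> x = (\<lambda>_. 0) x"
    by (intro sigma_finite_measure.density_unique_banach[OF sigma_finite_lborel] \<psi>) (auto simp: sets set_lebesgue_integral_def)
  then show ?thesis by simp
qed

text \<open>
The function \<open>d\<close> need not be integrable, so it is first multiplied by \<open>exp (- x\<^sup>2)\<close>; the product \<open>\<psi>\<close> still
integrates to 0 against all Gaussians. The indicator of an interval, convolved with narrower and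
narrower Gaussians, stays bounded and converges except at the two endpoints, and so \<open>\<psi>\<close> integrates to 0
over the interval.
\<close>

lemma AE_zero_if_gaussian_integrals_zero:
  fixes d :: "real \<Rightarrow> complex"
  assumes [measurable]: "d \<in> borel_measurable borel"
    and int: "\<And>b c. c > 0 \<Longrightarrow> integrable lborel (\<lambda>x. d x * complex_of_real (exp (- c * (x - b)\<^sup>2)))"
    and zero: "\<And>b c. c > 0 \<Longrightarrow> (LINT x|lborel. d x * complex_of_real (exp (- c * (x - b)\<^sup>2))) = 0"
  shows "AE x in lborel. d x = 0"
proof -
  define \<psi> where "\<psi> x = d x * complex_of_real (exp (- x\<^sup>2))" for x
  have \<psi>: "integrable lborel \<psi>"
    using int[of 1 0] by (simp add: \<psi>_def[abs_def])
  have [measurable]: "\<psi> \<in> borel_measurable borel" using \<psi> by auto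
  define K where "K s z = sqrt (s / pi) * exp (- s * z\<^sup>2)" for s z :: real
  have [measurable]: "K s \<in> borel_measurable borel" for s unfolding K_def by measurable
  have K0: "K s z \<ge> 0" if "s > 0" for s z using that by (simp add: K_def)
  have Kdens: "K s (y - x) = normal_density x (1 / sqrt (2 * s)) y" if "s > 0" for s x y
    using that by (simp add: K_def normal_density_def power_divide real_sqrt_divide field_simps)
  have Kint: "integrable lborel (\<lambda>y. K s (y - x))" "(LINT y|lborel. K s (y - x)) = 1" if "s > 0" for s x
    unfolding Kdens[OF that] using that by auto
  have K1: "integrable lborel (K 1)" "integral\<^sup>L lborel (K 1) = 1"
    using Kint[of 1 0] by auto
  \<comment> \<open>completing the square: a product of two Gaussians is a Gaussian\<close>
  have inner: "(LINT x|lborel. \<psi> x * complex_of_real (K s (y - x))) = 0" if s: "s > 0" for s y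
  proof -
    define c where "c = 1 + s"
    define b where "b = s * y / c"
    have c: "c > 0" using s by (simp add: c_def)
    have "- x\<^sup>2 + (- s * (y - x)\<^sup>2) = - c * (x - b)\<^sup>2 + (c * b\<^sup>2 - s * y\<^sup>2)" for x
    proof -
      have "c * b = s * y" using c by (simp add: b_def)
      then show ?thesis unfolding c_def by algebra
    qed
    then have e: "exp (- x\<^sup>2) * exp (- s * (y - x)\<^sup>2) = exp (- c * (x - b)\<^sup>2) * exp (c * b\<^sup>2 - s * y\<^sup>2)" for x
      by (simp only: exp_add[symmetric])
    have "\<psi> x * complex_of_real (K s (y - x)) =
        complex_of_real (sqrt (s / pi) * exp (c * b\<^sup>2 - s * y\<^sup>2)) * (d x * complex_of_real (exp (- c * (x - b)\<^sup>2)))" for x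
    proof -
      have "\<psi> x * complex_of_real (K s (y - x)) = d x * complex_of_real (sqrt (s / pi) * (exp (- x\<^sup>2) * exp (- s * (y - x)\<^sup>2)))"
        unfolding \<psi>_def K_def by simp
      also have "\<dots> = complex_of_real (sqrt (s / pi) * exp (c * b\<^sup>2 - s * y\<^sup>2)) * (d x * complex_of_real (exp (- c * (x - b)\<^sup>2)))"
        unfolding e by simp
      finally show ?thesis .
    qed
    then have "(LINT x|lborel. \<psi> x * complex_of_real (K s (y - x))) =
        complex_of_real (sqrt (s / pi) * exp (c * b\<^sup>2 - s * y\<^sup>2)) * (LINT x|lborel. d x * complex_of_real (exp (- c * (x - b)\<^sup>2)))"
      by (simp only: integral_mult_right_zero)
    then show ?thesis using zero[OF c] by simp
  qed
  have "(LINT x:{a<..<b}|lborel. \<psi> x) = 0" for a b :: real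
  proof -
    define \<phi> where "\<phi> = indicat_real {a<..<b}"
    have [measurable]: "\<phi> \<in> borel_measurable borel" unfolding \<phi>_def by measurable
    have \<phi>_le: "0 \<le> \<phi> y" "\<phi> y \<le> 1" "\<bar>\<phi> y\<bar> \<le> 1" for y by (auto simp: \<phi>_def indicator_def)
    define M where "M s x = (LINT y|lborel. \<phi> y * K s (y - x))" for s x
    have [measurable]: "M s \<in> borel_measurable borel" for s unfolding M_def by measurable
    have M_bound: "\<bar>M s x\<bar> \<le> 1" if "s > 0" for s x
    proof -
      have "\<bar>M s x\<bar> \<le> (LINT y|lborel. \<bar>\<phi> y * K s (y - x)\<bar>)"
        unfolding M_def by (rule integral_abs_bound)
      also have "\<dots> \<le> (LINT y|lborel. K s (y - x))"
        using Kint(1)[OF that] K0[OF that] \<phi>_le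
        by (intro integral_mono' ) (auto simp: abs_mult intro!: mult_left_le_one_le)
      finally show ?thesis using Kint(2)[OF that] by simp
    qed
    \<comment> \<open>Fubini moves the interval to the outside, where the inner integral against a Gaussian vanishes\<close>
    have M_zero: "(LINT x|lborel. \<psi> x * complex_of_real (M s x)) = 0" if s: "s > 0" for s
    proof -
      let ?k = "\<lambda>x y. \<psi> x * complex_of_real (\<phi> y * K s (y - x))"
      have int\<phi>: "integrable lborel (\<lambda>y. \<phi> y * K s (y - x))" for x
        by (rule Bochner_Integration.integrable_bound[OF Kint(1)[OF s, of x]])
           (use \<phi>_le K0[OF s] in \<open>auto simp: abs_mult intro!: mult_left_le_one_le\<close>)
      have k: "integrable (lborel \<Otimes>\<^sub>M lborel) (case_prod ?k)"
      proof (rule lborel_pair.Fubini_integrable)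
        show "case_prod ?k \<in> borel_measurable (lborel \<Otimes>\<^sub>M lborel)" by measurable
        have eq: "(LINT y|lborel. norm (case (x, y) of (x, y) \<Rightarrow> ?k x y)) = M s x * norm (\<psi> x)" for x
          using \<phi>_le K0[OF s] by (simp add: norm_mult M_def abs_mult mult.commute)
        show "integrable lborel (\<lambda>x. LINT y|lborel. norm (case (x, y) of (x, y) \<Rightarrow> ?k x y))"
          unfolding eq
          by (rule Bochner_Integration.integrable_bound[OF integrable_norm[OF \<psi>]])
             (use M_bound[OF s] in \<open>auto simp: abs_mult intro!: mult_left_le_one_le\<close>)
        show "AE x in lborel. integrable lborel (\<lambda>y. case (x, y) of (x, y) \<Rightarrow> ?k x y)"
          using int\<phi> by (intro AE_I2) (auto simp del: of_real_mult intro!: integrable_mult_right integrable_of_real)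
      qed
      have "(LINT x|lborel. \<psi> x * complex_of_real (M s x)) = (LINT x|lborel. LINT y|lborel. ?k x y)"
        unfolding M_def by (simp del: of_real_mult)
      also have "\<dots> = (LINT y|lborel. LINT x|lborel. ?k x y)"
        by (rule lborel_pair.Fubini_integral[OF k, symmetric])
      also have "\<dots> = (LINT y|lborel. complex_of_real (\<phi> y) * (LINT x|lborel. \<psi> x * complex_of_real (K s (y - x))))"
        by (simp flip: integral_mult_right_zero add: mult_ac)
      also have "\<dots> = 0" using inner[OF s] by simp
      finally show ?thesis .
    qed
    \<comment> \<open>rescaling the convolution lets dominated convergence act under a fixed Gaussian\<close>
    have M_shift: "M ((real (Suc n))\<^sup>2) x = (LINT z|lborel. \<phi> (x + (1 / real (Suc n)) * z) * K 1 z)" for n x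
    proof -
      let ?r = "1 / real (Suc n)"
      have r: "?r * real (Suc n) = 1" by simp
      have Kr: "K ((real (Suc n))\<^sup>2) (?r * z) = real (Suc n) * K 1 z" for z
      proof -
        have "K ((real (Suc n))\<^sup>2) (?r * z) = sqrt ((real (Suc n))\<^sup>2 / pi) * exp (- (real (Suc n) * (?r * z))\<^sup>2)"
          unfolding K_def by (simp only: power_mult_distrib minus_mult_left)
        also have "real (Suc n) * (?r * z) = z" by simp
        finally show ?thesis unfolding K_def by (simp add: real_sqrt_divide)
      qed
      have "M ((real (Suc n))\<^sup>2) x = \<bar>?r\<bar> *\<^sub>R (LINT z|lborel. \<phi> (x + ?r * z) * K ((real (Suc n))\<^sup>2) ((x + ?r * z) - x))"
        unfolding M_def by (rule lborel_integral_real_affine) simp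
      also have "\<dots> = ?r * (LINT z|lborel. real (Suc n) * (\<phi> (x + ?r * z) * K 1 z))"
        unfolding add_diff_cancel_left' Kr mult.left_commute[of _ "real (Suc n)"] by simp
      finally show ?thesis by simp
    qed
    have M_lim: "(\<lambda>n. M ((real (Suc n))\<^sup>2) x) \<longlonglongrightarrow> \<phi> x" if x: "x \<noteq> a" "x \<noteq> b" for x
    proof -
      have "(\<lambda>n. LINT z|lborel. \<phi> (x + (1 / real (Suc n)) * z) * K 1 z) \<longlonglongrightarrow> (LINT z|lborel. \<phi> x * K 1 z)"
      proof (rule integral_dominated_convergence[where w="K 1"])
        show "AE z in lborel. (\<lambda>n. \<phi> (x + (1 / real (Suc n)) * z) * K 1 z) \<longlonglongrightarrow> \<phi> x * K 1 z"
        proof (intro AE_I2)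
          fix z
          have l: "(\<lambda>n. x + (1 / real (Suc n)) * z) \<longlonglongrightarrow> x + 0 * z"
            by (intro tendsto_intros LIMSEQ_Suc lim_1_over_n)
          have "\<forall>\<^sub>F n in sequentially. \<phi> (x + (1 / real (Suc n)) * z) = \<phi> x"
          proof (cases "x \<in> {a<..<b}")
            case True
            have "\<forall>\<^sub>F n in sequentially. x + (1 / real (Suc n)) * z \<in> {a<..<b}"
              using topological_tendstoD[OF l, of "{a<..<b}"] True by simp
            then show ?thesis by eventually_elim (use True in \<open>simp add: \<phi>_def\<close>)
          next
            case False
            have "\<forall>\<^sub>F n in sequentially. x + (1 / real (Suc n)) * z \<in> - {a..b}"
              by (rule topological_tendstoD[OF l]) (use False x in auto)
            then show ?thesis by eventually_elim (use False in \<open>auto simp: \<phi>_def indicator_def\<close>)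
          qed
          then show "(\<lambda>n. \<phi> (x + (1 / real (Suc n)) * z) * K 1 z) \<longlonglongrightarrow> \<phi> x * K 1 z"
            by (intro tendsto_intros tendsto_eventually)
        qed
        show "AE z in lborel. norm (\<phi> (x + (1 / real (Suc n)) * z) * K 1 z) \<le> K 1 z" for n
          using K0[of 1] \<phi>_le by (intro AE_I2) (auto simp: abs_mult intro!: mult_left_le_one_le)
      qed (use K1 in auto)
      then show ?thesis unfolding M_shift using K1 by simp
    qed
    have "(\<lambda>n. LINT x|lborel. \<psi> x * complex_of_real (M ((real (Suc n))\<^sup>2) x)) \<longlonglongrightarrow> (LINT x|lborel. \<psi> x * complex_of_real (\<phi> x))"
    proof (rule integral_dominated_convergence[where w="\<lambda>x. norm (\<psi> x)"])
      have "AE x in lborel. x \<noteq> a" "AE x in lborel. x \<noteq> b" by (rule AE_lborel_singleton)+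
      then show "AE x in lborel. (\<lambda>n. \<psi> x * complex_of_real (M ((real (Suc n))\<^sup>2) x)) \<longlonglongrightarrow> \<psi> x * complex_of_real (\<phi> x)"
        by eventually_elim (intro tendsto_intros M_lim)
      show "AE x in lborel. norm (\<psi> x * complex_of_real (M ((real (Suc n))\<^sup>2) x)) \<le> norm (\<psi> x)" for n
        using M_bound[of "(real (Suc n))\<^sup>2"] by (intro AE_I2) (auto simp: norm_mult intro!: mult_right_le_one_le)
    qed (use \<psi> in auto)
    moreover have "(LINT x|lborel. \<psi> x * complex_of_real (M ((real (Suc n))\<^sup>2) x)) = 0" for n
      by (rule M_zero) simp
    ultimately have "(LINT x|lborel. \<psi> x * complex_of_real (\<phi> x)) = 0"
      by (simp only: LIMSEQ_const_iff)
    then show ?thesis by (simp add: set_lebesgue_integral_def \<phi>_def scaleR_conv_of_real mult.commute)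
  qed
  from AE_zero_if_interval_integrals_zero[OF \<psi> this]
  show ?thesis by (simp add: \<psi>_def)
qed

lemma bounded_poly_times_gaussian:
  fixes p :: "real poly"
  assumes "c > 0"
  shows "\<exists>B. \<forall>y. \<bar>poly p y\<bar> * exp (- c * y\<^sup>2) \<le> B"
  using assms
proof (induction p arbitrary: c)
  case 0
  then show ?case by auto
next
  case (pCons a p)
  from pCons.IH[of "c / 2"] pCons.prems obtain B
    where B: "\<And>y. \<bar>poly p y\<bar> * exp (- (c / 2) * y\<^sup>2) \<le> B" by auto
  have B0: "B \<ge> 0" using B[of 0] abs_ge_zero[of "poly p 0"] by simp
  have lin: "\<bar>y\<bar> * exp (- (c / 2) * y\<^sup>2) \<le> 1 + 2 / c" for y
  proof -
    have "\<bar>y\<bar> \<le> 1 + y\<^sup>2"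
      using sum_squares_bound[of "\<bar>y\<bar>" 1] abs_ge_zero[of y]
      unfolding power2_abs one_power2 mult_1_right by linarith
    also have "\<dots> \<le> (1 + 2 / c) * (1 + (c / 2) * y\<^sup>2)"
    proof -
      have "(1 + 2 / c) * (1 + (c / 2) * y\<^sup>2) = 1 + y\<^sup>2 + (2 / c + (c / 2) * y\<^sup>2)"
        using pCons.prems by (simp add: field_simps)
      then show ?thesis using pCons.prems by simp
    qed
    also have "\<dots> \<le> (1 + 2 / c) * exp ((c / 2) * y\<^sup>2)"
      using pCons.prems by (intro mult_left_mono exp_ge_add_one_self) auto
    finally show ?thesis by (simp add: exp_minus field_simps)
  qed
  have "\<bar>poly (pCons a p) y\<bar> * exp (- c * y\<^sup>2) \<le> \<bar>a\<bar> + (1 + 2 / c) * B" for y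
  proof -
    have e: "exp (- c * y\<^sup>2) = exp (- (c / 2) * y\<^sup>2) * exp (- (c / 2) * y\<^sup>2)"
      by (simp flip: exp_add)
    have "\<bar>poly (pCons a p) y\<bar> * exp (- c * y\<^sup>2) \<le> (\<bar>a\<bar> + \<bar>y\<bar> * \<bar>poly p y\<bar>) * exp (- c * y\<^sup>2)"
      by (intro mult_right_mono) (auto simp: abs_mult[symmetric])
    also have "\<dots> = \<bar>a\<bar> * exp (- c * y\<^sup>2) + (\<bar>y\<bar> * exp (- (c / 2) * y\<^sup>2)) * (\<bar>poly p y\<bar> * exp (- (c / 2) * y\<^sup>2))"
      unfolding e by (simp add: algebra_simps)
    also have "\<dots> \<le> \<bar>a\<bar> * 1 + (1 + 2 / c) * B"
      using pCons.prems by (intro add_mono mult_mono lin B) auto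
    finally show ?thesis by simp
  qed
  then show ?case by blast
qed

text \<open>
The derivatives are Gaussians times polynomials, where differentiation acts on the polynomial as
\<open>p \<mapsto> p' - 2 c y p\<close> in the variable \<open>y = x - b\<close>.
\<close>

lemma schwartz_gaussian:
  fixes b c :: real
  assumes c: "c > 0"
  shows "schwartz (\<lambda>x. complex_of_real (exp (- c * (x - b)\<^sup>2)))"
  unfolding schwartz_def
proof (intro exI conjI allI)
  define q where "q n = ((\<lambda>p. pderiv p + [:0, - 2 * c:] * p) ^^ n) 1" for n
  define r where "r n x = poly (q n) (x - b) * exp (- c * (x - b)\<^sup>2)" for n x
  show "(\<lambda>x. complex_of_real (r 0 x)) = (\<lambda>x. complex_of_real (exp (- c * (x - b)\<^sup>2)))"
    by (simp add: r_def q_def)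
  show "((\<lambda>x. complex_of_real (r n x)) has_vector_derivative complex_of_real (r (Suc n) x)) (at x)" for n x
  proof -
    have "(r n has_real_derivative r (Suc n) x) (at x)"
      unfolding r_def by (auto intro!: derivative_eq_intros simp: q_def algebra_simps)
    then show ?thesis
      by (intro has_vector_derivative_of_real) (simp add: has_real_derivative_iff_has_vector_derivative)
  qed
  show "bounded (range (\<lambda>x. x ^ m *\<^sub>R complex_of_real (r n x)))" for m n
  proof -
    obtain B where B: "\<And>y. \<bar>poly ([:b, 1:] ^ m * q n) y\<bar> * exp (- c * y\<^sup>2) \<le> B"
      using bounded_poly_times_gaussian[OF c] by blast
    have "norm (x ^ m *\<^sub>R complex_of_real (r n x)) \<le> B" for x
      using B[of "x - b"] by (simp add: r_def abs_mult norm_mult norm_power power_abs mult.assoc)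
    then show ?thesis unfolding bounded_iff by blast
  qed
qed

section \<open>The Fourier transform of square integrable functions\<close>

lemma Lp_norm_power:
  assumes "p > 0"
  shows "Lp_norm p M f ^ p = (\<integral>\<^sup>+ x. ennreal (norm (f x) ^ p) \<partial>M)"
proof (cases "(\<integral>\<^sup>+ x. ennreal (norm (f x) ^ p) \<partial>M) = \<infinity>")
  case True
  then show ?thesis using assms by (simp add: Lp_norm_def power_eq_top_ennreal)
next
  case False
  then show ?thesis
    using assms by (simp add: Lp_norm_def Let_def ennreal_power ennreal_enn2real_if)
qed

lemma ennreal_power_le_iff:
  fixes a b :: ennreal
  assumes "p > 0"
  shows "a ^ p \<le> b ^ p \<longleftrightarrow> a \<le> b"
proof
  assume le: "a ^ p \<le> b ^ p"
  show "a \<le> b"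
  proof (rule ccontr)
    assume "\<not> a \<le> b"
    then have "b ^ p < a ^ p"
      using assms by (cases a; cases b)
        (auto simp: ennreal_power ennreal_less_iff not_le top_power_ennreal intro!: power_strict_mono)
    then show False using le by simp
  qed
qed (rule power_mono, auto)

lemma Lp_norm_le_iff:
  assumes "p > 0"
  shows "Lp_norm p M f \<le> B \<longleftrightarrow> (\<integral>\<^sup>+ x. ennreal (norm (f x) ^ p) \<partial>M) \<le> B ^ p"
  unfolding Lp_norm_power[OF assms, symmetric] ennreal_power_le_iff[OF assms] ..

definition cutoff :: "real \<Rightarrow> (real \<Rightarrow> complex) \<Rightarrow> real \<Rightarrow> complex" where
  "cutoff R f x = indicator {-R..R} x *\<^sub>R f x"

lemma borel_measurable_cutoff [measurable]:
  "f \<in> borel_measurable borel \<Longrightarrow> cutoff R f \<in> borel_measurable borel"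
  unfolding cutoff_def[abs_def] by measurable

lemma L2sq_cong_AE: "AE x in lborel. f x = g x \<Longrightarrow> L2sq f = L2sq g"
  unfolding L2sq_def by (rule nn_integral_cong_AE) (erule eventually_mono, simp)

lemma L2sq_mono: "(\<And>x. norm (f x) \<le> norm (g x)) \<Longrightarrow> L2sq f \<le> L2sq g"
  unfolding L2sq_def by (intro nn_integral_mono ennreal_leI power_mono) auto

lemma L2sq_cutoff_le: "L2sq (cutoff R f) \<le> L2sq f"
  by (rule L2sq_mono) (simp add: cutoff_def indicator_def)

lemma L2sq_cmult:
  assumes [measurable]: "f \<in> borel_measurable borel"
  shows "L2sq (\<lambda>x. c * f x) = ennreal (norm c ^ 2) * L2sq f"
  unfolding L2sq_def
  by (subst nn_integral_cmult[symmetric]) (auto simp: norm_mult power_mult_distrib ennreal_mult)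

lemma L2sq_reflect:
  assumes [measurable]: "f \<in> borel_measurable borel"
  shows "L2sq (\<lambda>x. f (- x)) = L2sq f"
proof -
  have "L2sq f = ennreal \<bar>- 1\<bar> * (\<integral>\<^sup>+ x. ennreal (norm (f (0 + (- 1) * x)) ^ 2) \<partial>lborel)"
    unfolding L2sq_def by (rule nn_integral_real_affine) auto
  then show ?thesis by (simp add: L2sq_def)
qed

lemma L2sq_diff_le:
  assumes [measurable]: "f \<in> borel_measurable borel" "g \<in> borel_measurable borel" "h \<in> borel_measurable borel"
  shows "L2sq (\<lambda>x. f x - g x) \<le> 2 * (L2sq (\<lambda>x. f x - h x) + L2sq (\<lambda>x. h x - g x))"
proof -
  have "norm (f x - g x) ^ 2 \<le> 2 * (norm (f x - h x) ^ 2 + norm (h x - g x) ^ 2)" for x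
  proof -
    have "norm (f x - g x) \<le> norm (f x - h x) + norm (h x - g x)"
      using norm_triangle_ineq[of "f x - h x" "h x - g x"] by simp
    then have "norm (f x - g x) ^ 2 \<le> (norm (f x - h x) + norm (h x - g x)) ^ 2"
      by (rule power_mono) simp
    also have "\<dots> \<le> 2 * (norm (f x - h x) ^ 2 + norm (h x - g x) ^ 2)"
      using sum_squares_bound[of "norm (f x - h x)" "norm (h x - g x)"] by (simp add: power2_sum)
    finally show ?thesis .
  qed
  then have "L2sq (\<lambda>x. f x - g x) \<le> (\<integral>\<^sup>+ x. 2 * (ennreal (norm (f x - h x) ^ 2) + ennreal (norm (h x - g x) ^ 2)) \<partial>lborel)"
    unfolding L2sq_def by (intro nn_integral_mono) (simp flip: ennreal_plus ennreal_mult ennreal_numeral)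
  also have "\<dots> = 2 * (L2sq (\<lambda>x. f x - h x) + L2sq (\<lambda>x. h x - g x))"
    unfolding L2sq_def by (simp add: nn_integral_cmult nn_integral_add)
  finally show ?thesis .
qed

text \<open>
Lower semicontinuity with a varying bound: the bounds in use are a fixed tail plus an error that
tends to 0.
\<close>

lemma L2sq_fatou:
  assumes [measurable]: "\<And>n. u n \<in> borel_measurable borel"
    and lim: "AE x in lborel. (\<lambda>n. u n x) \<longlonglongrightarrow> v x"
    and le: "\<And>n. L2sq (u n) \<le> B n" and B: "B \<longlonglongrightarrow> B'"
  shows "L2sq v \<le> B'"
proof -
  have "L2sq v = (\<integral>\<^sup>+ x. liminf (\<lambda>n. ennreal (norm (u n x) ^ 2)) \<partial>lborel)"
    unfolding L2sq_def
  proof (rule nn_integral_cong_AE, use lim in eventually_elim)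
    fix x assume "(\<lambda>n. u n x) \<longlonglongrightarrow> v x"
    then have "(\<lambda>n. ennreal (norm (u n x) ^ 2)) \<longlonglongrightarrow> ennreal (norm (v x) ^ 2)"
      by (intro tendsto_intros)
    then show "ennreal (norm (v x) ^ 2) = liminf (\<lambda>n. ennreal (norm (u n x) ^ 2))"
      by (intro lim_imp_Liminf[symmetric]) simp
  qed
  also have "\<dots> \<le> liminf (\<lambda>n. L2sq (u n))"
    unfolding L2sq_def by (rule nn_integral_liminf) measurable
  also have "\<dots> \<le> liminf B"
    by (intro Liminf_mono always_eventually allI le)
  also have "liminf B = B'" using B by (intro lim_imp_Liminf) simp
  finally show ?thesis .
qed

text \<open>
The increments are summable almost everywhere by \<open>\<bar>d\<bar> \<le> 2\<^sup>-\<^sup>n + 2\<^sup>n \<bar>d\<bar>\<^sup>2\<close>: the sum of \<open>2\<^sup>n \<bar>d n\<bar>\<^sup>2\<close> has finite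
integral, because the ratio \<open>1 / 8\<close> absorbs the weight \<open>2\<^sup>n\<close>.
\<close>

lemma AE_convergent_if_L2sq_geometric:
  assumes [measurable]: "\<And>n. u n \<in> borel_measurable borel"
    and C: "C \<ge> 0"
    and le: "\<And>n. L2sq (\<lambda>x. u (Suc n) x - u n x) \<le> ennreal (C * (1 / 8) ^ n)"
  shows "AE x in lborel. convergent (\<lambda>n. u n x)"
proof -
  define d where "d n x = u (Suc n) x - u n x" for n x
  have [measurable]: "d n \<in> borel_measurable borel" for n unfolding d_def by measurable
  have "(\<integral>\<^sup>+ x. (\<Sum>n. ennreal (2 ^ n * norm (d n x) ^ 2)) \<partial>lborel) = (\<Sum>n. \<integral>\<^sup>+ x. ennreal (2 ^ n * norm (d n x) ^ 2) \<partial>lborel)"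
    by (rule nn_integral_suminf) measurable
  also have "\<dots> \<le> (\<Sum>n. ennreal (C * (1 / 4) ^ n))"
  proof (rule suminf_le)
    fix n
    have "(\<integral>\<^sup>+ x. ennreal (2 ^ n * norm (d n x) ^ 2) \<partial>lborel) = ennreal (2 ^ n) * L2sq (d n)"
      unfolding L2sq_def by (subst nn_integral_cmult[symmetric]) (auto simp: ennreal_mult)
    also have "\<dots> \<le> ennreal (2 ^ n) * ennreal (C * (1 / 8) ^ n)"
      using le[of n] unfolding d_def[abs_def] by (intro mult_left_mono) auto
    also have "\<dots> = ennreal (C * (1 / 4) ^ n)"
      using C by (simp flip: ennreal_mult power_mult_distrib)
    finally show "(\<integral>\<^sup>+ x. ennreal (2 ^ n * norm (d n x) ^ 2) \<partial>lborel) \<le> ennreal (C * (1 / 4) ^ n)" .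
  qed auto
  also have "\<dots> < \<infinity>"
  proof -
    have "summable (\<lambda>n. C * (1 / 4 :: real) ^ n)" by (intro summable_mult summable_geometric) simp
    then have "(\<Sum>n. ennreal (C * (1 / 4) ^ n)) = ennreal (\<Sum>n. C * (1 / 4) ^ n)"
      using C by (intro suminf_ennreal2) auto
    then show ?thesis by simp
  qed
  finally have "AE x in lborel. (\<Sum>n. ennreal (2 ^ n * norm (d n x) ^ 2)) \<noteq> \<infinity>"
    by (intro nn_integral_noteq_infinite) auto
  then show ?thesis
  proof eventually_elim
    fix x assume fin: "(\<Sum>n. ennreal (2 ^ n * norm (d n x) ^ 2)) \<noteq> \<infinity>"
    have s1: "summable (\<lambda>n. 2 ^ n * norm (d n x) ^ 2)"
      by (rule summable_suminf_not_top) (use fin in \<open>auto simp: infinity_ennreal_def\<close>)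
    have "summable (\<lambda>n. (1 / 2) ^ n + 2 ^ n * norm (d n x) ^ 2)"
      by (intro summable_add s1 summable_geometric) simp
    moreover have "norm (d n x) \<le> (1 / 2) ^ n + 2 ^ n * norm (d n x) ^ 2" for n
    proof -
      define a where "a = (2::real) ^ n * norm (d n x)"
      have p: "(2::real) ^ n > 0" by simp
      have a0: "a \<ge> 0" by (simp add: a_def)
      have "a \<le> 1 + a\<^sup>2"
        using sum_squares_bound[of a 1] a0 unfolding one_power2 mult_1_right by linarith
      moreover have "2 ^ n * ((1 / 2) ^ n + 2 ^ n * norm (d n x) ^ 2) = 1 + a\<^sup>2"
      proof -
        have "(2::real) ^ n * (1 / 2) ^ n = 1" by (simp flip: power_mult_distrib)
        then show ?thesis by (simp add: a_def power2_eq_square distrib_left mult_ac)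
      qed
      ultimately have "2 ^ n * norm (d n x) \<le> 2 ^ n * ((1 / 2) ^ n + 2 ^ n * norm (d n x) ^ 2)"
        by (simp add: a_def)
      then show ?thesis using p by (simp only: mult_le_cancel_left_pos)
    qed
    ultimately have "summable (\<lambda>n. d n x)"
      by (rule summable_comparison_test')
    then have "convergent (\<lambda>n. \<Sum>i<n. d i x)" by (simp add: summable_iff_convergent)
    then have "convergent (\<lambda>n. u 0 x + (\<Sum>i<n. d i x))" by (intro convergent_add convergent_const)
    moreover have "u 0 x + (\<Sum>i<n. d i x) = u n x" for n
      using sum_lessThan_telescope[of "\<lambda>i. u i x" n] by (simp add: d_def)
    ultimately show "convergent (\<lambda>n. u n x)" by simp
  qed
qed

lemma ennreal_tendsto_0_le:
  fixes f g :: "'a \<Rightarrow> ennreal"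
  assumes "\<And>x. f x \<le> g x" "(g \<longlongrightarrow> 0) F"
  shows "(f \<longlongrightarrow> 0) F"
  by (rule tendsto_sandwich[OF _ _ tendsto_const assms(2)]) (auto intro: always_eventually assms(1))

lemma L2sq_tail_tendsto_0:
  assumes [measurable]: "f \<in> borel_measurable borel" and fin: "L2sq f < \<infinity>"
  shows "((\<lambda>R. L2sq (\<lambda>x. f x - cutoff R f x)) \<longlongrightarrow> 0) at_top"
proof (rule tendsto_at_topI_sequentially)
  fix X :: "nat \<Rightarrow> real" assume X: "filterlim X at_top sequentially"
  have "(\<lambda>n. \<integral>\<^sup>+ x. ennreal (norm (f x - cutoff (X n) f x) ^ 2) \<partial>lborel) \<longlonglongrightarrow> (\<integral>\<^sup>+ x. 0 \<partial>(lborel :: real measure))"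
  proof (rule nn_integral_dominated_convergence[where w="\<lambda>x. ennreal (norm (f x) ^ 2)"])
    show "AE x in lborel. (\<lambda>n. ennreal (norm (f x - cutoff (X n) f x) ^ 2)) \<longlonglongrightarrow> 0"
    proof (intro AE_I2 tendsto_eventually)
      fix x
      have "\<forall>\<^sub>F n in sequentially. \<bar>x\<bar> \<le> X n"
        using X by (simp add: filterlim_at_top)
      then show "\<forall>\<^sub>F n in sequentially. ennreal (norm (f x - cutoff (X n) f x) ^ 2) = 0"
        by eventually_elim (simp add: cutoff_def indicator_def abs_le_iff)
    qed
    show "AE x in lborel. ennreal (norm (f x - cutoff (X j) f x) ^ 2) \<le> ennreal (norm (f x) ^ 2)" for j
      by (intro AE_I2 ennreal_leI power_mono) (auto simp: cutoff_def indicator_def)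
  qed (use fin in \<open>auto simp: L2sq_def\<close>)
  then show "(\<lambda>n. L2sq (\<lambda>x. f x - cutoff (X n) f x)) \<longlonglongrightarrow> 0"
    by (simp add: L2sq_def)
qed

text \<open>
The cutoff radii depend on \<open>f\<close> only through the size of its tails. They can therefore be shared by all
functions with the same modulus, such as the free evolutions of one datum.
\<close>

lemma fast_cutoff_exists:
  assumes "f \<in> borel_measurable borel" "L2sq f < \<infinity>"
  obtains k :: "nat \<Rightarrow> real" where "\<And>n. L2sq (\<lambda>x. f x - cutoff (k n) f x) \<le> ennreal ((1 / 8) ^ n)"
proof -
  have "\<exists>R. L2sq (\<lambda>x. f x - cutoff R f x) \<le> ennreal ((1 / 8) ^ n)" for n
  proof -
    have "\<forall>\<^sub>F R in at_top. L2sq (\<lambda>x. f x - cutoff R f x) < ennreal ((1 / 8) ^ n)"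
      using L2sq_tail_tendsto_0[OF assms] by (rule order_tendstoD) simp
    then obtain R where "L2sq (\<lambda>x. f x - cutoff R f x) < ennreal ((1 / 8) ^ n)"
      by (auto simp: eventually_at_top_linorder)
    then show ?thesis by (auto intro: less_imp_le)
  qed
  then show thesis using that by metis
qed

lemma integrable_cutoff:
  assumes [measurable]: "f \<in> borel_measurable borel" and fin: "L2sq f < \<infinity>"
  shows "integrable lborel (cutoff R f)"
proof (rule Bochner_Integration.integrable_bound)
  have "integrable lborel (\<lambda>x. norm (f x) ^ 2)"
    using fin by (intro integrableI_bounded) (auto simp: L2sq_def)
  then show "integrable lborel (\<lambda>x. indicat_real {-R..R} x + norm (f x) ^ 2)"
    by (intro Bochner_Integration.integrable_add) (auto intro!: integrable_real_indicator simp: emeasure_lborel_Icc_eq)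
  show "AE x in lborel. norm (cutoff R f x) \<le> norm (indicat_real {-R..R} x + norm (f x) ^ 2)"
  proof (intro AE_I2)
    fix x
    have "norm (f x) \<le> 1 + norm (f x) ^ 2"
      using sum_squares_bound[of "norm (f x)" 1] norm_ge_zero[of "f x"] unfolding one_power2 mult_1_right by linarith
    then show "norm (cutoff R f x) \<le> norm (indicat_real {-R..R} x + norm (f x) ^ 2)"
      by (auto simp: cutoff_def indicator_def)
  qed
qed measurable

lemma fourier_diff:
  assumes "integrable lborel f" "integrable lborel g"
  shows "fourier (\<lambda>x. f x - g x) \<xi> = fourier f \<xi> - fourier g \<xi>"
  unfolding fourier_def right_diff_distrib
  using assms by (intro Bochner_Integration.integral_diff integrable_cis_mult) auto

lemma L2sq_fourier_cutoff_diff: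
  assumes [measurable]: "f \<in> borel_measurable borel" and fin: "L2sq f < \<infinity>"
  shows "L2sq (\<lambda>\<xi>. fourier (cutoff R f) \<xi> - fourier (cutoff R' f) \<xi>) \<le>
     ennreal (2 * pi) * (L2sq (\<lambda>x. f x - cutoff R f x) + L2sq (\<lambda>x. f x - cutoff R' f x))"
proof -
  have int: "integrable lborel (cutoff R f)" "integrable lborel (cutoff R' f)"
    using assms by (auto intro: integrable_cutoff)
  have "L2sq (\<lambda>\<xi>. fourier (cutoff R f) \<xi> - fourier (cutoff R' f) \<xi>) = L2sq (fourier (\<lambda>x. cutoff R f x - cutoff R' f x))"
    unfolding fourier_diff[OF int, abs_def] ..
  also have "\<dots> \<le> ennreal (2 * pi) * L2sq (\<lambda>x. cutoff R f x - cutoff R' f x)"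
    by (intro fourier_L2_bound Bochner_Integration.integrable_diff int)
  also have "L2sq (\<lambda>x. cutoff R f x - cutoff R' f x) \<le> (\<integral>\<^sup>+ x. ennreal (norm (f x - cutoff R f x) ^ 2) + ennreal (norm (f x - cutoff R' f x) ^ 2) \<partial>lborel)"
    unfolding L2sq_def by (intro nn_integral_mono) (auto simp: cutoff_def indicator_def)
  also have "\<dots> = L2sq (\<lambda>x. f x - cutoff R f x) + L2sq (\<lambda>x. f x - cutoff R' f x)"
    unfolding L2sq_def by (rule nn_integral_add) measurable
  finally show ?thesis by (simp add: mult_left_mono)
qed

definition fourier_lim :: "(nat \<Rightarrow> real) \<Rightarrow> (real \<Rightarrow> complex) \<Rightarrow> real \<Rightarrow> complex" where
  "fourier_lim k f \<xi> = lim (\<lambda>n. fourier (cutoff (k n) f) \<xi>)"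

lemma borel_measurable_fourier_lim [measurable]:
  "f \<in> borel_measurable borel \<Longrightarrow> fourier_lim k f \<in> borel_measurable borel"
  unfolding fourier_lim_def[abs_def] by measurable

text \<open>
The truncated Fourier integrals along fast radii converge almost everywhere; Fatou's lemma then
compares the limit with the truncation at any other radius. The radius \<open>-1\<close> truncates to the zero
function and gives the bound for the limit itself.
\<close>

lemma
  assumes [measurable]: "f \<in> borel_measurable borel" and fin: "L2sq f < \<infinity>"
    and k: "\<And>n. L2sq (\<lambda>x. f x - cutoff (k n) f x) \<le> ennreal ((1 / 8) ^ n)"
  shows fourier_cutoff_tendsto: "AE \<xi> in lborel. (\<lambda>n. fourier (cutoff (k n) f) \<xi>) \<longlonglongrightarrow> fourier_lim k f \<xi>"
    and L2sq_fourier_cutoff_minus_lim: "L2sq (\<lambda>\<xi>. fourier (cutoff R f) \<xi> - fourier_lim k f \<xi>) \<le> ennreal (2 * pi) * L2sq (\<lambda>x. f x - cutoff R f x)"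
    and L2sq_fourier_lim: "L2sq (fourier_lim k f) \<le> ennreal (2 * pi) * L2sq f"
proof -
  have "AE \<xi> in lborel. convergent (\<lambda>n. fourier (cutoff (k n) f) \<xi>)"
  proof (rule AE_convergent_if_L2sq_geometric[where C="4 * pi"])
    fix n
    have "L2sq (\<lambda>\<xi>. fourier (cutoff (k (Suc n)) f) \<xi> - fourier (cutoff (k n) f) \<xi>) \<le>
       ennreal (2 * pi) * (ennreal ((1 / 8) ^ n) + ennreal ((1 / 8) ^ n))"
      by (rule order_trans[OF L2sq_fourier_cutoff_diff[OF assms(1,2)]])
         (intro mult_left_mono add_mono k order_trans[OF k] ennreal_leI power_decreasing, auto)
    also have "\<dots> = ennreal (4 * pi * (1 / 8) ^ n)"
      by (simp flip: ennreal_plus ennreal_mult)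
    finally show "L2sq (\<lambda>\<xi>. fourier (cutoff (k (Suc n)) f) \<xi> - fourier (cutoff (k n) f) \<xi>) \<le> ennreal (4 * pi * (1 / 8) ^ n)" .
  qed auto
  then show lim: "AE \<xi> in lborel. (\<lambda>n. fourier (cutoff (k n) f) \<xi>) \<longlonglongrightarrow> fourier_lim k f \<xi>"
    unfolding fourier_lim_def by eventually_elim (simp add: convergent_LIMSEQ_iff)
  show main: "L2sq (\<lambda>\<xi>. fourier (cutoff R f) \<xi> - fourier_lim k f \<xi>) \<le> ennreal (2 * pi) * L2sq (\<lambda>x. f x - cutoff R f x)" for R
  proof (rule L2sq_fatou[where u="\<lambda>n \<xi>. fourier (cutoff R f) \<xi> - fourier (cutoff (k n) f) \<xi>"])
    show "AE \<xi> in lborel. (\<lambda>n. fourier (cutoff R f) \<xi> - fourier (cutoff (k n) f) \<xi>) \<longlonglongrightarrow> fourier (cutoff R f) \<xi> - fourier_lim k f \<xi>"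
      using lim by eventually_elim (intro tendsto_intros)
    show "L2sq (\<lambda>\<xi>. fourier (cutoff R f) \<xi> - fourier (cutoff (k n) f) \<xi>) \<le> ennreal (2 * pi) * (L2sq (\<lambda>x. f x - cutoff R f x) + ennreal ((1 / 8) ^ n))" for n
      by (rule order_trans[OF L2sq_fourier_cutoff_diff[OF assms(1,2)]]) (intro mult_left_mono add_mono k order_refl, auto)
    have "(\<lambda>n. ennreal (2 * pi) * (L2sq (\<lambda>x. f x - cutoff R f x) + ennreal ((1 / 8) ^ n))) \<longlonglongrightarrow>
        ennreal (2 * pi) * (L2sq (\<lambda>x. f x - cutoff R f x) + ennreal 0)"
      by (intro ennreal_tendsto_cmult tendsto_add tendsto_const tendsto_ennrealI LIMSEQ_power_zero) auto
    then show "(\<lambda>n. ennreal (2 * pi) * (L2sq (\<lambda>x. f x - cutoff R f x) + ennreal ((1 / 8) ^ n))) \<longlonglongrightarrow>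
        ennreal (2 * pi) * L2sq (\<lambda>x. f x - cutoff R f x)" by simp
  qed measurable
  have "cutoff (- 1) f = (\<lambda>x. 0)" by (auto simp: cutoff_def)
  then show "L2sq (fourier_lim k f) \<le> ennreal (2 * pi) * L2sq f"
    using main[of "- 1"] by (simp add: fourier_def L2sq_def)
qed

lemma Lp_norm_2_power: "Lp_norm 2 lborel f ^ 2 = L2sq f" for f :: "real \<Rightarrow> complex"
  unfolding L2sq_def by (rule Lp_norm_power) simp

text \<open>
Replaces the root in the norm by the bare integral, to which Fatou's lemma applies directly.
\<close>

lemma Lp_norm_2_tendsto_0_iff:
  fixes F :: "'i \<Rightarrow> real \<Rightarrow> complex"
  shows "((\<lambda>R. Lp_norm 2 lborel (F R)) \<longlongrightarrow> 0) A \<longleftrightarrow> ((\<lambda>R. L2sq (F R)) \<longlongrightarrow> 0) A"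
proof
  assume l: "((\<lambda>R. Lp_norm 2 lborel (F R)) \<longlongrightarrow> 0) A"
  have "((\<lambda>R. Lp_norm 2 lborel (F R) * Lp_norm 2 lborel (F R)) \<longlongrightarrow> 0 * 0) A"
    using l by (intro tendsto_mult_ennreal) auto
  then show "((\<lambda>R. L2sq (F R)) \<longlongrightarrow> 0) A"
    by (simp add: Lp_norm_2_power[symmetric] power2_eq_square)
next
  assume l: "((\<lambda>R. L2sq (F R)) \<longlongrightarrow> 0) A"
  show "((\<lambda>R. Lp_norm 2 lborel (F R)) \<longlongrightarrow> 0) A"
  proof (rule order_tendstoI)
    fix e :: ennreal assume "0 < e"
    then have "0 < e ^ 2" by (simp add: zero_less_iff_neq_zero)
    from order_tendstoD(2)[OF l this]
    show "\<forall>\<^sub>F R in A. Lp_norm 2 lborel (F R) < e"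
    proof eventually_elim
      case (elim R)
      then show ?case
        using ennreal_power_le_iff[of 2 e "Lp_norm 2 lborel (F R)"] unfolding Lp_norm_2_power by (simp add: not_le[symmetric])
    qed
  qed auto
qed

lemma is_L2_limit_iff:
  "is_L2_limit F g \<longleftrightarrow> g \<in> borel_measurable borel \<and> L2sq g < \<infinity> \<and> ((\<lambda>R. L2sq (\<lambda>x. F R x - g x)) \<longlongrightarrow> 0) at_top"
proof -
  have "Lp_norm 2 lborel g < \<infinity> \<longleftrightarrow> L2sq g < \<infinity>"
    unfolding Lp_norm_2_power[symmetric] by (simp add: power_less_top_ennreal)
  then show ?thesis
    unfolding is_L2_limit_def Lp_norm_2_tendsto_0_iff by simp
qed

lemma is_L2_limit_unique:
  assumes [measurable]: "\<And>R. F R \<in> borel_measurable borel"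
    and g: "is_L2_limit F g" and h: "is_L2_limit F h"
  shows "AE x in lborel. g x = h x"
proof -
  have [measurable]: "g \<in> borel_measurable borel" "h \<in> borel_measurable borel"
    using g h by (auto simp: is_L2_limit_iff)
  have "((\<lambda>R. 2 * (L2sq (\<lambda>x. g x - F R x) + L2sq (\<lambda>x. F R x - h x))) \<longlongrightarrow> 2 * (0 + 0)) at_top"
    using g h by (intro ennreal_tendsto_cmult tendsto_add) (auto simp: is_L2_limit_iff L2sq_def norm_minus_commute)
  then have "L2sq (\<lambda>x. g x - h x) \<le> 2 * (0 + 0)"
    by (rule tendsto_lowerbound) (intro always_eventually allI L2sq_diff_le, auto)
  then have "L2sq (\<lambda>x. g x - h x) = 0" by simp
  then show ?thesis
    unfolding L2sq_def by (subst (asm) nn_integral_0_iff_AE) auto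
qed

lemma truncated_fourier_eq:
  "(LINT x:{-R..R}|lborel. cis (- (x * \<xi>)) * f x) = fourier (cutoff R f) \<xi>"
  by (simp add: set_lebesgue_integral_def fourier_def cutoff_def)

definition inv_fourier :: "(real \<Rightarrow> complex) \<Rightarrow> real \<Rightarrow> complex" where
  "inv_fourier g x = complex_of_real (1 / (2 * pi)) * fourier g (- x)"

lemma borel_measurable_inv_fourier [measurable]:
  assumes [measurable]: "f \<in> borel_measurable borel"
  shows "inv_fourier f \<in> borel_measurable borel"
  unfolding inv_fourier_def by measurable

lemma truncated_inv_fourier_eq:
  "complex_of_real (1 / (2 * pi)) * (LINT \<xi>:{-R..R}|lborel. cis (x * \<xi>) * g \<xi>) = inv_fourier (cutoff R g) x"
  by (simp add: set_lebesgue_integral_def inv_fourier_def fourier_def cutoff_def mult.commute)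

text \<open>
An \<open>L\<^sup>2\<close> limit exists, so the Hilbert choice in \<open>fourier_L2\<close> does pick one.
\<close>

lemma
  assumes [measurable]: "f \<in> borel_measurable borel" and fin: "L2sq f < \<infinity>"
  shows is_L2_limit_fourier_L2: "is_L2_limit (\<lambda>R. fourier (cutoff R f)) (fourier_L2 f)"
    and L2sq_fourier_L2_le: "L2sq (fourier_L2 f) \<le> ennreal (2 * pi) * L2sq f"
proof -
  obtain k where k: "\<And>n. L2sq (\<lambda>x. f x - cutoff (k n) f x) \<le> ennreal ((1 / 8) ^ n)"
    using fast_cutoff_exists[OF assms] by blast
  have "is_L2_limit (\<lambda>R. fourier (cutoff R f)) (fourier_lim k f)"
    unfolding is_L2_limit_iff
  proof (intro conjI)
    show "L2sq (fourier_lim k f) < \<infinity>"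
      by (rule le_less_trans[OF L2sq_fourier_lim[OF assms k]]) (use fin in \<open>simp add: ennreal_mult_less_top\<close>)
    have "((\<lambda>R. ennreal (2 * pi) * L2sq (\<lambda>x. f x - cutoff R f x)) \<longlongrightarrow> ennreal (2 * pi) * 0) at_top"
      by (intro ennreal_tendsto_cmult L2sq_tail_tendsto_0 assms) auto
    then show "((\<lambda>R. L2sq (\<lambda>\<xi>. fourier (cutoff R f) \<xi> - fourier_lim k f \<xi>)) \<longlongrightarrow> 0) at_top"
      by (intro ennreal_tendsto_0_le[OF L2sq_fourier_cutoff_minus_lim[OF assms k]]) simp
  qed measurable
  note lim = this
  show l: "is_L2_limit (\<lambda>R. fourier (cutoff R f)) (fourier_L2 f)"
    unfolding fourier_L2_def truncated_fourier_eq by (rule someI[of "is_L2_limit _", OF lim])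
  have "AE \<xi> in lborel. fourier_L2 f \<xi> = fourier_lim k f \<xi>"
    by (rule is_L2_limit_unique[OF _ l lim]) measurable
  then have "L2sq (fourier_L2 f) = L2sq (fourier_lim k f)"
    by (rule L2sq_cong_AE)
  then show "L2sq (fourier_L2 f) \<le> ennreal (2 * pi) * L2sq f"
    using L2sq_fourier_lim[OF assms k] by simp
qed

text \<open>
The inverse transform is the forward one, reflected and divided by \<open>2 pi\<close>. The limit is named
explicitly, with the radii \<open>k\<close>, because its joint measurability in a time parameter matters later.
\<close>

lemma is_L2_limit_inv_fourier_lim:
  assumes [measurable]: "g \<in> borel_measurable borel" and fin: "L2sq g < \<infinity>"
    and k: "\<And>n. L2sq (\<lambda>x. g x - cutoff (k n) g x) \<le> ennreal ((1 / 8) ^ n)"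
  shows "is_L2_limit (\<lambda>R. inv_fourier (cutoff R g)) (\<lambda>x. complex_of_real (1 / (2 * pi)) * fourier_lim k g (- x))"
  unfolding is_L2_limit_iff
proof (intro conjI)
  have scale: "L2sq (\<lambda>x. complex_of_real (1 / (2 * pi)) * f (- x)) = ennreal ((1 / (2 * pi)) ^ 2) * L2sq f"
    if [measurable]: "f \<in> borel_measurable borel" for f
    by (subst L2sq_cmult) (auto simp: L2sq_reflect norm_divide)
  show "L2sq (\<lambda>x. complex_of_real (1 / (2 * pi)) * fourier_lim k g (- x)) < \<infinity>"
    by (subst scale, measurable, rule le_less_trans[OF mult_left_mono[OF L2sq_fourier_lim[OF assms]]])
       (use fin in \<open>simp_all add: ennreal_mult_less_top\<close>)
  have lim0: "((\<lambda>R. ennreal ((1 / (2 * pi)) ^ 2) * (ennreal (2 * pi) * L2sq (\<lambda>x. g x - cutoff R g x))) \<longlongrightarrow>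
      ennreal ((1 / (2 * pi)) ^ 2) * (ennreal (2 * pi) * 0)) at_top"
    by (intro ennreal_tendsto_cmult L2sq_tail_tendsto_0 assms) auto
  have le: "L2sq (\<lambda>x. inv_fourier (cutoff R g) x - complex_of_real (1 / (2 * pi)) * fourier_lim k g (- x))
     \<le> ennreal ((1 / (2 * pi)) ^ 2) * (ennreal (2 * pi) * L2sq (\<lambda>x. g x - cutoff R g x))" for R
  proof -
    have "L2sq (\<lambda>x. inv_fourier (cutoff R g) x - complex_of_real (1 / (2 * pi)) * fourier_lim k g (- x))
       = ennreal ((1 / (2 * pi)) ^ 2) * L2sq (\<lambda>x. fourier (cutoff R g) x - fourier_lim k g x)"
      by (subst scale[symmetric]) (auto simp: inv_fourier_def right_diff_distrib)
    then show ?thesis using L2sq_fourier_cutoff_minus_lim[OF assms] by (simp add: mult_left_mono)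
  qed
  show "((\<lambda>R. L2sq (\<lambda>x. inv_fourier (cutoff R g) x - complex_of_real (1 / (2 * pi)) * fourier_lim k g (- x))) \<longlongrightarrow> 0) at_top"
    using lim0 by (intro ennreal_tendsto_0_le[OF le]) simp
qed measurable

lemma inv_fourier_L2_eq:
  assumes [measurable]: "g \<in> borel_measurable borel" and lim: "is_L2_limit (\<lambda>R. inv_fourier (cutoff R g)) f"
  shows "AE x in lborel. inv_fourier_L2 g x = f x"
proof (rule is_L2_limit_unique[OF _ _ lim])
  show "is_L2_limit (\<lambda>R. inv_fourier (cutoff R g)) (inv_fourier_L2 g)"
    unfolding inv_fourier_L2_def truncated_inv_fourier_eq by (rule someI[of "is_L2_limit _", OF lim])
qed measurable

section \<open>Fourier inversion for band-limited functions\<close>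

lemma integrable_L2_mult:
  assumes [measurable]: "a \<in> borel_measurable borel" "b \<in> borel_measurable borel"
    and fin: "L2sq a < \<infinity>" "L2sq b < \<infinity>"
  shows "integrable lborel (\<lambda>x. a x * b x)"
proof (rule Bochner_Integration.integrable_bound)
  have "integrable lborel (\<lambda>x. norm (a x) ^ 2)" "integrable lborel (\<lambda>x. norm (b x) ^ 2)"
    using fin by (auto intro!: integrableI_bounded simp: L2sq_def)
  then show "integrable lborel (\<lambda>x. norm (a x) ^ 2 + norm (b x) ^ 2)"
    by (rule Bochner_Integration.integrable_add)
  show "AE x in lborel. norm (a x * b x) \<le> norm (norm (a x) ^ 2 + norm (b x) ^ 2)"
  proof (intro AE_I2)
    fix x
    have "norm (a x) * norm (b x) \<le> norm (a x) ^ 2 + norm (b x) ^ 2"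
      using sum_squares_bound[of "norm (a x)" "norm (b x)"] mult_nonneg_nonneg[OF norm_ge_zero[of "a x"] norm_ge_zero[of "b x"]]
      by linarith
    then show "norm (a x * b x) \<le> norm (norm (a x) ^ 2 + norm (b x) ^ 2)"
      by (simp add: norm_mult)
  qed
qed measurable

lemma norm_integral_mult_le_L2:
  assumes [measurable]: "a \<in> borel_measurable borel" "b \<in> borel_measurable borel"
    and fin: "L2sq a < \<infinity>" "L2sq b < \<infinity>"
  shows "ennreal (norm (LINT x|lborel. a x * b x) ^ 2) \<le> L2sq a * L2sq b"
proof -
  have "ennreal (norm (LINT x|lborel. a x * b x)) \<le> (\<integral>\<^sup>+ x. norm (a x * b x) \<partial>lborel)"
    by (intro integral_norm_bound_ennreal integrable_L2_mult assms)
  then have "ennreal (norm (LINT x|lborel. a x * b x)) ^ 2 \<le> (\<integral>\<^sup>+ x. ennreal (norm (a x)) * ennreal (norm (b x)) \<partial>lborel) ^ 2"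
    by (intro power_mono) (simp_all add: norm_mult ennreal_mult)
  also have "\<dots> \<le> L2sq a * L2sq b"
    using Cauchy_Schwarz_nn_integral[of "\<lambda>x. ennreal (norm (a x))" lborel "\<lambda>x. ennreal (norm (b x))"]
    by (simp add: L2sq_def ennreal_power)
  finally show ?thesis by (simp add: ennreal_power)
qed

text \<open>
By the Cauchy-Schwarz inequality, \<open>L\<^sup>2\<close> convergence may be tested against square integrable functions.
\<close>

lemma L2_limit_weak:
  assumes g: "is_L2_limit F g"
    and [measurable]: "\<And>R. F R \<in> borel_measurable borel" "\<phi> \<in> borel_measurable borel"
    and fin: "\<And>R. L2sq (F R) < \<infinity>" "L2sq \<phi> < \<infinity>"
  shows "((\<lambda>R. LINT x|lborel. F R x * \<phi> x) \<longlongrightarrow> (LINT x|lborel. g x * \<phi> x)) at_top"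
proof -
  have [measurable]: "g \<in> borel_measurable borel" and gfin: "L2sq g < \<infinity>"
    and lim: "((\<lambda>R. L2sq (\<lambda>x. F R x - g x)) \<longlongrightarrow> 0) at_top"
    using g by (auto simp: is_L2_limit_iff)
  have dfin: "L2sq (\<lambda>x. F R x - g x) < \<infinity>" for R
  proof -
    have "L2sq (\<lambda>x. F R x - g x) \<le> 2 * (L2sq (\<lambda>x. F R x - 0) + L2sq (\<lambda>x. 0 - g x))"
      by (rule L2sq_diff_le) measurable
    also have "\<dots> < \<infinity>"
      using fin(1)[of R] gfin by (simp add: ennreal_mult_less_top L2sq_def)
    finally show ?thesis .
  qed
  have le: "ennreal (norm ((LINT x|lborel. F R x * \<phi> x) - (LINT x|lborel. g x * \<phi> x)) ^ 2) \<le> L2sq (\<lambda>x. F R x - g x) * L2sq \<phi>" for R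
  proof -
    have "(LINT x|lborel. F R x * \<phi> x) - (LINT x|lborel. g x * \<phi> x) = (LINT x|lborel. (F R x - g x) * \<phi> x)"
      unfolding left_diff_distrib
      by (intro Bochner_Integration.integral_diff[symmetric] integrable_L2_mult fin gfin) measurable
    then show ?thesis
      using norm_integral_mult_le_L2[OF _ _ dfin fin(2), of R] by simp
  qed
  have "((\<lambda>R. L2sq (\<lambda>x. F R x - g x) * L2sq \<phi>) \<longlongrightarrow> 0 * L2sq \<phi>) at_top"
    using lim fin(2) by (intro tendsto_mult_ennreal tendsto_const) auto
  then have "((\<lambda>R. ennreal (norm ((LINT x|lborel. F R x * \<phi> x) - (LINT x|lborel. g x * \<phi> x)) ^ 2)) \<longlongrightarrow> ennreal 0) at_top"
    using ennreal_tendsto_0_le[OF le] by simp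
  then have "((\<lambda>R. norm ((LINT x|lborel. F R x * \<phi> x) - (LINT x|lborel. g x * \<phi> x)) ^ 2) \<longlongrightarrow> 0) at_top"
    by (subst (asm) tendsto_ennreal_iff) auto
  then have "((\<lambda>R. sqrt (norm ((LINT x|lborel. F R x * \<phi> x) - (LINT x|lborel. g x * \<phi> x)) ^ 2)) \<longlongrightarrow> sqrt 0) at_top"
    by (intro tendsto_intros)
  then show ?thesis
    by (simp add: LIM_zero_iff tendsto_norm_zero_iff)
qed

lemma fourier_reflect: "fourier (\<lambda>x. f (- x)) \<xi> = fourier f (- \<xi>)"
proof -
  have "fourier f (- \<xi>) = \<bar>- 1\<bar> *\<^sub>R (LINT x|lborel. cis (- ((0 + (- 1) * x) * (- \<xi>))) * f (0 + (- 1) * x))"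
    unfolding fourier_def by (rule lborel_integral_real_affine) simp
  then show ?thesis by (simp add: fourier_def)
qed

lemma fourier_cong_AE:
  assumes [measurable]: "f \<in> borel_measurable borel" "g \<in> borel_measurable borel"
    and "AE x in lborel. f x = g x"
  shows "fourier f \<xi> = fourier g \<xi>"
  unfolding fourier_def
  by (rule integral_cong_AE) (measurable, use assms(3) in eventually_elim, simp)

lemma L2sq_gaussian:
  fixes b c :: real
  assumes c: "c > 0"
  shows "L2sq (\<lambda>x. complex_of_real (exp (- c * (x - b)\<^sup>2))) < \<infinity>"
proof -
  have "norm (complex_of_real (exp (- c * (x - b)\<^sup>2))) ^ 2 = exp (- (2 * c) * (x - b)\<^sup>2)" for x
    by (simp flip: exp_of_nat_mult)
  then show ?thesis
    unfolding L2sq_def using integrable_gaussian[of "2 * c" b] c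
    by (subst nn_integral_eq_integral) (auto simp: less_top[symmetric])
qed

lemma L2sq_inv_fourier_le:
  assumes "integrable lborel h"
  shows "ennreal (2 * pi) * L2sq (inv_fourier h) \<le> L2sq h"
proof -
  have [measurable]: "h \<in> borel_measurable borel" using assms by auto
  have assoc: "ennreal a * (ennreal b * (ennreal a * X)) = ennreal (a * (b * a)) * X" if "a \<ge> 0" "b \<ge> 0" for a b X
    using that by (simp add: ennreal_mult mult.assoc)
  have "L2sq (inv_fourier h) = ennreal ((1 / (2 * pi)) ^ 2) * L2sq (fourier h)"
    unfolding inv_fourier_def by (subst L2sq_cmult) (auto simp: L2sq_reflect norm_divide)
  also have "\<dots> \<le> ennreal ((1 / (2 * pi)) ^ 2) * (ennreal (2 * pi) * L2sq h)"
    by (intro mult_left_mono fourier_L2_bound assms) auto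
  finally have "ennreal (2 * pi) * L2sq (inv_fourier h) \<le> ennreal (2 * pi) * (ennreal ((1 / (2 * pi)) ^ 2) * (ennreal (2 * pi) * L2sq h))"
    by (rule mult_left_mono) simp
  also have "\<dots> = ennreal (2 * pi * ((1 / (2 * pi)) ^ 2 * (2 * pi))) * L2sq h"
    by (rule assoc) simp_all
  also have "2 * pi * ((1 / (2 * pi)) ^ 2 * (2 * pi)) = 1" by (simp add: power2_eq_square)
  finally show ?thesis by simp
qed

text \<open>
For these spectra \<open>h\<close> all inversion integrals converge absolutely, so solutions and their fractional
derivatives are given by explicit formulas.
\<close>

definition band_limited :: "real \<Rightarrow> (real \<Rightarrow> complex) \<Rightarrow> bool" where
  "band_limited R h \<longleftrightarrow> h \<in> borel_measurable borel \<and> L2sq h < \<infinity> \<and> (\<forall>\<xi>. R < \<bar>\<xi>\<bar> \<longrightarrow> h \<xi> = 0)"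

lemma band_limited_measurable [measurable_dest]: "band_limited R h \<Longrightarrow> h \<in> borel_measurable borel"
  by (simp add: band_limited_def)

lemma cutoff_band_limited: "band_limited R h \<Longrightarrow> R \<le> R' \<Longrightarrow> cutoff R' h = h"
  by (auto simp: band_limited_def cutoff_def fun_eq_iff indicator_def abs_le_iff)

lemma band_limited_integrable: "band_limited R h \<Longrightarrow> integrable lborel h"
  using integrable_cutoff[of h R] cutoff_band_limited[of R h R] by (simp add: band_limited_def)

lemma L2sq_inv_fourier_finite: "band_limited R h \<Longrightarrow> L2sq (inv_fourier h) < \<infinity>"
proof -
  assume h: "band_limited R h"
  have "ennreal (2 * pi) * L2sq (inv_fourier h) < \<infinity>"
    using L2sq_inv_fourier_le[OF band_limited_integrable[OF h]] h
    by (auto simp: band_limited_def elim: order.strict_trans1)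
  then show ?thesis by (auto simp: ennreal_mult_less_top)
qed

lemma band_limited_mult:
  assumes h: "band_limited R h" and [measurable]: "m \<in> borel_measurable borel"
    and B: "\<And>\<xi>. \<bar>\<xi>\<bar> \<le> R \<Longrightarrow> norm (m \<xi>) \<le> B"
  shows "band_limited R (\<lambda>\<xi>. m \<xi> * h \<xi>)"
proof -
  have [measurable]: "h \<in> borel_measurable borel" using h by (rule band_limited_measurable)
  have "L2sq (\<lambda>\<xi>. m \<xi> * h \<xi>) \<le> L2sq (\<lambda>\<xi>. complex_of_real (max 0 B) * h \<xi>)"
  proof (rule L2sq_mono)
    fix \<xi>
    show "norm (m \<xi> * h \<xi>) \<le> norm (complex_of_real (max 0 B) * h \<xi>)"
    proof (cases "\<bar>\<xi>\<bar> \<le> R")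
      case True
      then show ?thesis using B[of \<xi>] by (auto simp: norm_mult intro!: mult_right_mono)
    next
      case False
      then show ?thesis using h by (simp add: band_limited_def)
    qed
  qed
  also have "\<dots> = ennreal (norm (complex_of_real (max 0 B)) ^ 2) * L2sq h"
    by (rule L2sq_cmult) measurable
  also have "\<dots> < \<infinity>" using h by (simp add: band_limited_def ennreal_mult_less_top)
  finally show ?thesis using h by (simp add: band_limited_def)
qed

lemma fourier_fourier_reflect_gaussian:
  fixes b c :: real
  assumes c: "c > 0"
  shows "fourier (\<lambda>x. fourier (\<lambda>x. complex_of_real (exp (- c * (x - b)\<^sup>2))) (- x)) \<xi>
    = complex_of_real (2 * pi * exp (- c * (\<xi> - b)\<^sup>2))"
proof -
  have eq: "fourier (\<lambda>x. complex_of_real (exp (- c * (x - b)\<^sup>2))) (- x) =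
     complex_of_real (sqrt (pi / c)) * (cis (b * x) * complex_of_real (exp (- (1 / (4 * c)) * x\<^sup>2)))" for x
    unfolding fourier_shifted_gaussian[OF c] by simp
  have "fourier (\<lambda>x. complex_of_real (sqrt (pi / c)) * (cis (b * x) * complex_of_real (exp (- (1 / (4 * c)) * x\<^sup>2)))) \<xi>
     = complex_of_real (sqrt (pi / c)) * fourier (\<lambda>x. cis (b * x) * complex_of_real (exp (- (1 / (4 * c)) * x\<^sup>2))) \<xi>"
    unfolding fourier_def by (simp flip: integral_mult_right_zero add: mult_ac)
  also have "fourier (\<lambda>x. cis (b * x) * complex_of_real (exp (- (1 / (4 * c)) * x\<^sup>2))) \<xi>
     = complex_of_real (sqrt (pi / (1 / (4 * c))) * exp (- (\<xi> - b)\<^sup>2 / (4 * (1 / (4 * c)))))"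
    by (rule fourier_modulated_gaussian) (use c in simp)
  also have "complex_of_real (sqrt (pi / c)) * \<dots> = complex_of_real ((sqrt (pi / c) * sqrt (pi / (1 / (4 * c)))) * exp (- (\<xi> - b)\<^sup>2 / (4 * (1 / (4 * c)))))"
    by simp
  also have "sqrt (pi / c) * sqrt (pi / (1 / (4 * c))) = sqrt ((2 * pi)\<^sup>2)"
    using c unfolding real_sqrt_mult[symmetric] by (simp add: power2_eq_square)
  also have "sqrt ((2 * pi)\<^sup>2) = 2 * pi" by (rule real_sqrt_unique) simp_all
  also have "- (\<xi> - b)\<^sup>2 / (4 * (1 / (4 * c))) = - c * (\<xi> - b)\<^sup>2"
    using c by simp
  finally show ?thesis unfolding eq .
qed

lemma integrable_fourier_gaussian:
  fixes b c :: real
  assumes c: "c > 0"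
  shows "integrable lborel (fourier (\<lambda>x. complex_of_real (exp (- c * (x - b)\<^sup>2))))"
proof -
  have "integrable lborel (\<lambda>\<xi>. complex_of_real (sqrt (pi / c)) * (cis (- b * \<xi>) * complex_of_real (exp (- (1 / (4 * c)) * (\<xi> - 0)\<^sup>2))))"
    using c by (intro integrable_mult_right integrable_cis_mult integrable_complex_gaussian) auto
  then show ?thesis
    unfolding fourier_shifted_gaussian[OF c, abs_def] by simp
qed

lemma inv_fourier_tested_with_fourier:
  assumes h: "integrable lborel h" and \<phi>: "integrable lborel \<phi>"
  shows "(LINT x|lborel. inv_fourier h x * \<phi> x) = complex_of_real (1 / (2 * pi)) * (LINT \<xi>|lborel. h \<xi> * fourier \<phi> (- \<xi>))"
proof -
  have r: "integrable lborel (\<lambda>x. \<phi> (- x))"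
    using lborel_integrable_real_affine[OF \<phi>, of "- 1" 0] by simp
  have "(LINT x|lborel. fourier h (- x) * \<phi> x) = \<bar>- 1\<bar> *\<^sub>R (LINT x|lborel. fourier h (- (0 + (- 1) * x)) * \<phi> (0 + (- 1) * x))"
    by (rule lborel_integral_real_affine) simp
  also have "\<dots> = (LINT x|lborel. fourier h x * \<phi> (- x))" by simp
  also have "\<dots> = (LINT \<xi>|lborel. h \<xi> * fourier \<phi> (- \<xi>))"
    unfolding fourier_duality[OF h r] fourier_reflect ..
  finally show ?thesis
    unfolding inv_fourier_def mult.assoc integral_mult_right_zero by simp
qed

text \<open>
Let \<open>u = inv_fourier h\<close> and let \<open>g\<close> be its transform in the \<open>L\<^sup>2\<close> sense. For a Gaussian \<open>G\<close>, duality
turns \<open>\<integral> g G\<close> into \<open>\<integral> u (fourier G)\<close>, the truncation being removed by dominated convergence since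
\<open>u\<close> is bounded. A second use of duality and the inversion formula for \<open>G\<close> itself give \<open>\<integral> h G\<close>.
\<close>

lemma fourier_L2_inv_fourier:
  assumes h: "band_limited R h"
  shows "AE \<xi> in lborel. fourier_L2 (inv_fourier h) \<xi> = h \<xi>"
proof -
  have [measurable]: "h \<in> borel_measurable borel" and hfin: "L2sq h < \<infinity>" and hint: "integrable lborel h"
    using h band_limited_integrable[OF h] by (auto simp: band_limited_def)
  define u where "u = inv_fourier h"
  define g where "g = fourier_L2 u"
  have [measurable]: "u \<in> borel_measurable borel" unfolding u_def by measurable
  have ufin: "L2sq u < \<infinity>" unfolding u_def by (rule L2sq_inv_fourier_finite[OF h])
  have lim: "is_L2_limit (\<lambda>R. fourier (cutoff R u)) g"
    unfolding g_def by (rule is_L2_limit_fourier_L2) (use ufin in auto)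
  have [measurable]: "g \<in> borel_measurable borel" and gfin: "L2sq g < \<infinity>"
    using lim by (auto simp: is_L2_limit_iff)
  have uint: "integrable lborel (cutoff R u)" for R
    using ufin by (intro integrable_cutoff) auto
  have u_bound: "norm (u x) \<le> (1 / (2 * pi)) * (LINT x|lborel. norm (h x))" for x
    unfolding u_def inv_fourier_def norm_mult using norm_fourier_le[of h "- x"]
    by (intro mult_mono) (auto simp: norm_divide)
  have tested: "integrable lborel (\<lambda>x. (g x - h x) * complex_of_real (exp (- c * (x - b)\<^sup>2))) \<and>
     (LINT x|lborel. (g x - h x) * complex_of_real (exp (- c * (x - b)\<^sup>2))) = 0" if c: "c > 0" for b c :: real
  proof -
    define G where "G x = complex_of_real (exp (- c * (x - b)\<^sup>2))" for x
    have [measurable]: "G \<in> borel_measurable borel" unfolding G_def by measurable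
    have Gfin: "L2sq G < \<infinity>" using L2sq_gaussian[OF c, of b] by (simp add: G_def[abs_def])
    have G: "integrable lborel G" using integrable_complex_gaussian[OF c, of b] by (simp add: G_def[abs_def])
    have FG: "integrable lborel (fourier G)" using integrable_fourier_gaussian[OF c, of b] by (simp add: G_def[abs_def])
    have gG: "integrable lborel (\<lambda>x. g x * G x)" and hG: "integrable lborel (\<lambda>x. h x * G x)"
      by (auto intro!: integrable_L2_mult gfin hfin Gfin)
    have "((\<lambda>R. LINT x|lborel. fourier (cutoff R u) x * G x) \<longlongrightarrow> (LINT x|lborel. g x * G x)) at_top"
    proof (rule L2_limit_weak[OF lim])
      show "L2sq (fourier (cutoff R u)) < \<infinity>" for R
      proof -
        have "L2sq (fourier (cutoff R u)) \<le> ennreal (2 * pi) * L2sq (cutoff R u)"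
          by (rule fourier_L2_bound[OF uint])
        also have "\<dots> \<le> ennreal (2 * pi) * L2sq u"
          by (intro mult_left_mono L2sq_cutoff_le) simp
        also have "\<dots> < \<infinity>" using ufin by (simp add: ennreal_mult_less_top)
        finally show ?thesis .
      qed
    qed (use Gfin in auto)
    moreover have "(LINT x|lborel. fourier (cutoff R u) x * G x) = (LINT x|lborel. cutoff R u x * fourier G x)" for R
      by (rule fourier_duality[OF uint G])
    moreover have "((\<lambda>R. LINT x|lborel. cutoff R u x * fourier G x) \<longlongrightarrow> (LINT x|lborel. u x * fourier G x)) at_top"
    proof (rule integral_dominated_convergence_at_top[where w="\<lambda>x. ((1 / (2 * pi)) * (LINT x|lborel. norm (h x))) * norm (fourier G x)"])
      show "AE x in lborel. ((\<lambda>R. cutoff R u x * fourier G x) \<longlongrightarrow> u x * fourier G x) at_top"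
      proof (intro AE_I2 tendsto_eventually)
        fix x
        show "\<forall>\<^sub>F R in at_top. cutoff R u x * fourier G x = u x * fourier G x"
          using eventually_ge_at_top[of "\<bar>x\<bar>"] by eventually_elim (auto simp: cutoff_def indicator_def abs_le_iff)
      qed
      show "\<forall>\<^sub>F R in at_top. AE x in lborel. norm (cutoff R u x * fourier G x) \<le> ((1 / (2 * pi)) * (LINT x|lborel. norm (h x))) * norm (fourier G x)"
      proof (intro always_eventually allI AE_I2)
        fix R x
        have "norm (cutoff R u x) \<le> norm (u x)" by (simp add: cutoff_def indicator_def)
        also note u_bound
        finally show "norm (cutoff R u x * fourier G x) \<le> ((1 / (2 * pi)) * (LINT x|lborel. norm (h x))) * norm (fourier G x)"
          unfolding norm_mult by (rule mult_right_mono) simp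
      qed
      show "integrable lborel (\<lambda>x. ((1 / (2 * pi)) * (LINT x|lborel. norm (h x))) * norm (fourier G x))"
        using FG by (intro integrable_mult_right integrable_norm)
    qed measurable
    ultimately have "(LINT x|lborel. g x * G x) = (LINT x|lborel. u x * fourier G x)"
      using tendsto_unique[OF trivial_limit_at_top_linorder] by simp
    also have "\<dots> = complex_of_real (1 / (2 * pi)) * (LINT \<xi>|lborel. h \<xi> * fourier (\<lambda>x. fourier G (- x)) \<xi>)"
      unfolding u_def inv_fourier_tested_with_fourier[OF hint FG] fourier_reflect ..
    also have "\<dots> = (LINT \<xi>|lborel. h \<xi> * G \<xi>)"
      unfolding G_def fourier_fourier_reflect_gaussian[OF c]
      by (simp flip: integral_mult_right_zero)
    finally show ?thesis
      using gG hG unfolding left_diff_distrib G_def[symmetric] by simp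
  qed
  have "AE x in lborel. g x - h x = 0"
    by (rule AE_zero_if_gaussian_integrals_zero) (use tested in auto)
  then show ?thesis unfolding g_def u_def by simp
qed

text \<open>
The truncated integrals are constant from the radius \<open>R\<close> on, so the \<open>L\<^sup>2\<close> limit is the integral.
\<close>

lemma inv_fourier_L2_band_limited:
  assumes h: "band_limited R h" and [measurable]: "g \<in> borel_measurable borel"
    and gh: "AE \<xi> in lborel. g \<xi> = h \<xi>"
  shows "inv_fourier_L2 g \<in> borel_measurable borel"
    and "AE x in lborel. inv_fourier_L2 g x = inv_fourier h x"
proof -
  have [measurable]: "h \<in> borel_measurable borel" using h by (rule band_limited_measurable)
  have eq: "inv_fourier (cutoff R' g) = inv_fourier h" if "R \<le> R'" for R'
  proof
    fix x
    have "AE \<xi> in lborel. cutoff R' g \<xi> = h \<xi>"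
      using gh by eventually_elim (subst cutoff_band_limited[OF h that, symmetric], simp add: cutoff_def)
    then show "inv_fourier (cutoff R' g) x = inv_fourier h x"
      unfolding inv_fourier_def by (subst fourier_cong_AE[of "cutoff R' g" h]) auto
  qed
  have lim: "is_L2_limit (\<lambda>R. inv_fourier (cutoff R g)) (inv_fourier h)"
    unfolding is_L2_limit_iff
  proof (intro conjI)
    have "\<forall>\<^sub>F R' in at_top. L2sq (\<lambda>x. inv_fourier (cutoff R' g) x - inv_fourier h x) = 0"
      using eventually_ge_at_top[of R] by eventually_elim (simp add: eq L2sq_def)
    then show "((\<lambda>R'. L2sq (\<lambda>x. inv_fourier (cutoff R' g) x - inv_fourier h x)) \<longlongrightarrow> 0) at_top"
      by (rule tendsto_eventually)
  qed (use L2sq_inv_fourier_finite[OF h] in auto)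
  have "is_L2_limit (\<lambda>R. inv_fourier (cutoff R g)) (inv_fourier_L2 g)"
    unfolding inv_fourier_L2_def truncated_inv_fourier_eq by (rule someI[of "is_L2_limit _", OF lim])
  then show "inv_fourier_L2 g \<in> borel_measurable borel" by (simp add: is_L2_limit_iff)
  show "AE x in lborel. inv_fourier_L2 g x = inv_fourier h x"
    by (rule inv_fourier_L2_eq[OF _ lim]) measurable
qed

lemma fourier_L2_cong_AE:
  assumes [measurable]: "f \<in> borel_measurable borel" "g \<in> borel_measurable borel"
    and eq: "AE x in lborel. f x = g x"
  shows "fourier_L2 f = fourier_L2 g"
proof -
  have "AE x in lborel. cutoff R f x = cutoff R g x" for R
    using eq by eventually_elim (simp add: cutoff_def)
  then have "fourier (cutoff R f) = fourier (cutoff R g)" for R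
    by (intro ext fourier_cong_AE) auto
  then show ?thesis unfolding fourier_L2_def truncated_fourier_eq by simp
qed

section \<open>Fractional derivatives of Airy solutions\<close>

lemma fourier_L2_airy_group:
  assumes h: "band_limited R h"
  shows "airy_group t (inv_fourier h) \<in> borel_measurable borel"
    and "L2sq (airy_group t (inv_fourier h)) < \<infinity>"
    and "AE \<xi> in lborel. fourier_L2 (airy_group t (inv_fourier h)) \<xi> = cis (t * \<xi> ^ 3) * h \<xi>"
proof -
  have [measurable]: "h \<in> borel_measurable borel" using h by (rule band_limited_measurable)
  have u: "is_L2_limit (\<lambda>R. fourier (cutoff R (inv_fourier h))) (fourier_L2 (inv_fourier h))"
    using L2sq_inv_fourier_finite[OF h] by (intro is_L2_limit_fourier_L2) auto
  have [measurable]: "fourier_L2 (inv_fourier h) \<in> borel_measurable borel"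
    using u by (simp add: is_L2_limit_iff)
  have th: "band_limited R (\<lambda>\<xi>. cis (t * \<xi> ^ 3) * h \<xi>)"
    by (rule band_limited_mult[OF h, where B=1]) auto
  have eq: "AE \<xi> in lborel. cis (t * \<xi> ^ 3) * fourier_L2 (inv_fourier h) \<xi> = cis (t * \<xi> ^ 3) * h \<xi>"
    using fourier_L2_inv_fourier[OF h] by eventually_elim simp
  have m: "(\<lambda>\<xi>. cis (t * \<xi> ^ 3) * fourier_L2 (inv_fourier h) \<xi>) \<in> borel_measurable borel" by measurable
  note A = inv_fourier_L2_band_limited[OF th m eq, folded airy_group_def]
  show A1: "airy_group t (inv_fourier h) \<in> borel_measurable borel" by (rule A(1))
  have "L2sq (airy_group t (inv_fourier h)) = L2sq (inv_fourier (\<lambda>\<xi>. cis (t * \<xi> ^ 3) * h \<xi>))"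
    by (rule L2sq_cong_AE[OF A(2)])
  then show "L2sq (airy_group t (inv_fourier h)) < \<infinity>"
    using L2sq_inv_fourier_finite[OF th] by simp
  have "fourier_L2 (airy_group t (inv_fourier h)) = fourier_L2 (inv_fourier (\<lambda>\<xi>. cis (t * \<xi> ^ 3) * h \<xi>))"
    by (rule fourier_L2_cong_AE[OF A1 _ A(2)]) measurable
  then show "AE \<xi> in lborel. fourier_L2 (airy_group t (inv_fourier h)) \<xi> = cis (t * \<xi> ^ 3) * h \<xi>"
    using fourier_L2_inv_fourier[OF th] by simp
qed

text \<open>
For a band-limited spectrum \<open>k\<close>, duality rewrites the right side of the defining identity as the pairing
of the test function with an absolutely convergent inversion integral. Gaussians are test functions
and determine \<open>w\<close>.
\<close>

lemma is_frac_deriv_unique: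
  assumes w: "is_frac_deriv \<alpha> f w" and \<alpha>: "\<alpha> \<ge> 0"
    and f: "f \<in> borel_measurable borel" "L2sq f < \<infinity>"
    and k: "band_limited R k" "AE \<xi> in lborel. fourier_L2 f \<xi> = k \<xi>"
  shows "AE x in lborel. w x = inv_fourier (\<lambda>\<xi>. complex_of_real (\<bar>\<xi>\<bar> powr \<alpha>) * k \<xi>) x"
proof -
  have [measurable]: "w \<in> borel_measurable borel" using w by (simp add: is_frac_deriv_def)
  have [measurable]: "fourier_L2 f \<in> borel_measurable borel"
    using is_L2_limit_fourier_L2[OF f] by (simp add: is_L2_limit_iff)
  have [measurable]: "k \<in> borel_measurable borel" using k by (auto dest: band_limited_measurable)
  define K where "K \<xi> = complex_of_real (\<bar>\<xi>\<bar> powr \<alpha>) * k \<xi>" for \<xi>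
  have "band_limited R K"
    unfolding K_def[abs_def] using \<alpha> by (intro band_limited_mult[OF k(1), where B="R powr \<alpha>"]) (auto intro!: powr_mono2)
  then have K: "integrable lborel K" by (rule band_limited_integrable)
  then have [measurable]: "K \<in> borel_measurable borel" by auto
  have tested: "integrable lborel (\<lambda>x. (w x - inv_fourier K x) * complex_of_real (exp (- c * (x - b)\<^sup>2))) \<and>
     (LINT x|lborel. (w x - inv_fourier K x) * complex_of_real (exp (- c * (x - b)\<^sup>2))) = 0" if c: "c > 0" for b c :: real
  proof -
    define G where "G x = complex_of_real (exp (- c * (x - b)\<^sup>2))" for x
    have [measurable]: "G \<in> borel_measurable borel" unfolding G_def by measurable
    have G: "integrable lborel G" using integrable_complex_gaussian[OF c, of b] by (simp add: G_def[abs_def])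
    have "schwartz G" using schwartz_gaussian[OF c, of b] by (simp add: G_def[abs_def])
    then have "has_bochner_integral lborel (\<lambda>x. w x * G x)
          (complex_of_real (1 / (2 * pi)) *
           (LINT \<xi>|lborel. complex_of_real (\<bar>\<xi>\<bar> powr \<alpha>) * fourier_L2 f \<xi> * fourier G (- \<xi>)))"
      using w by (simp add: is_frac_deriv_def)
    also have "(LINT \<xi>|lborel. complex_of_real (\<bar>\<xi>\<bar> powr \<alpha>) * fourier_L2 f \<xi> * fourier G (- \<xi>)) = (LINT \<xi>|lborel. K \<xi> * fourier G (- \<xi>))"
      by (rule integral_cong_AE) (measurable, use k(2) in eventually_elim, simp add: K_def)
    finally have wG: "has_bochner_integral lborel (\<lambda>x. w x * G x) (LINT x|lborel. inv_fourier K x * G x)"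
      unfolding inv_fourier_tested_with_fourier[OF K G] .
    have "integrable lborel (\<lambda>x. inv_fourier K x * G x)"
    proof (rule integrable_bounded_mult[OF G, where B="(1 / (2 * pi)) * (LINT x|lborel. norm (K x))"])
      show "norm (inv_fourier K x) \<le> (1 / (2 * pi)) * (LINT x|lborel. norm (K x))" for x
        unfolding inv_fourier_def norm_mult using norm_fourier_le[of K "- x"]
        by (intro mult_mono) (auto simp: norm_divide)
    qed measurable
    then show ?thesis
      using wG unfolding left_diff_distrib G_def[symmetric] by (simp add: has_bochner_integral_iff)
  qed
  have "AE x in lborel. w x - inv_fourier K x = 0"
    by (rule AE_zero_if_gaussian_integrals_zero) (use tested in auto)
  then show ?thesis unfolding K_def[abs_def] by simp
qed

section \<open>Space-time norms of evolutions\<close>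

definition L6pow :: "(real \<times> real \<Rightarrow> complex) \<Rightarrow> ennreal" where
  "L6pow U = (\<integral>\<^sup>+ p. ennreal (norm (U p) ^ 6) \<partial>lborel)"

lemma Lp_norm_6_power: "Lp_norm 6 lborel U ^ 6 = L6pow U" for U :: "real \<times> real \<Rightarrow> complex"
  unfolding L6pow_def by (rule Lp_norm_power) simp

lemma Lp_norm_6_le_iff: "Lp_norm 6 lborel U \<le> B \<longleftrightarrow> L6pow U \<le> B ^ 6" for U :: "real \<times> real \<Rightarrow> complex"
  unfolding L6pow_def by (rule Lp_norm_le_iff) simp

lemma nn_integral_lborel_iterated:
  fixes f :: "real \<times> real \<Rightarrow> ennreal"
  assumes "f \<in> borel_measurable borel"
  shows "(\<integral>\<^sup>+ p. f p \<partial>lborel) = (\<integral>\<^sup>+ t. \<integral>\<^sup>+ x. f (t, x) \<partial>lborel \<partial>lborel)"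
  unfolding lborel_prod[symmetric]
  by (rule lborel.nn_integral_fst[symmetric]) (use assms in \<open>simp add: lborel_prod\<close>)

lemma nn_integral_lborel_mono_AE:
  fixes f g :: "real \<times> real \<Rightarrow> ennreal"
  assumes [measurable]: "f \<in> borel_measurable borel" "g \<in> borel_measurable borel"
    and le: "AE t in lborel. AE x in lborel. f (t, x) \<le> g (t, x)"
  shows "(\<integral>\<^sup>+ p. f p \<partial>lborel) \<le> (\<integral>\<^sup>+ p. g p \<partial>lborel)"
  unfolding nn_integral_lborel_iterated[OF assms(1)] nn_integral_lborel_iterated[OF assms(2)]
  by (rule nn_integral_mono_AE) (use le in eventually_elim, rule nn_integral_mono_AE)

lemma L6pow_mono_AE:
  assumes [measurable]: "U \<in> borel_measurable borel" "V \<in> borel_measurable borel"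
    and eq: "AE t in lborel. AE x in lborel. norm (U (t, x)) \<le> norm (V (t, x))"
  shows "L6pow U \<le> L6pow V"
  unfolding L6pow_def
proof (rule nn_integral_lborel_mono_AE)
  show "AE t in lborel. AE x in lborel. ennreal (norm (U (t, x)) ^ 6) \<le> ennreal (norm (V (t, x)) ^ 6)"
    using eq by eventually_elim (erule eventually_mono, intro ennreal_leI power_mono, auto)
qed measurable

lemma L6pow_fatou:
  assumes [measurable]: "\<And>n. W n \<in> borel_measurable borel" "U \<in> borel_measurable borel"
    and lim: "AE t in lborel. AE x in lborel. (\<lambda>n. W n (t, x)) \<longlonglongrightarrow> U (t, x)"
    and le: "\<forall>\<^sub>F n in sequentially. L6pow (W n) \<le> B"
  shows "L6pow U \<le> B"
proof -
  have "L6pow U \<le> (\<integral>\<^sup>+ p. liminf (\<lambda>n. ennreal (norm (W n p) ^ 6)) \<partial>lborel)"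
    unfolding L6pow_def
  proof (rule nn_integral_lborel_mono_AE)
    show "AE t in lborel. AE x in lborel. ennreal (norm (U (t, x)) ^ 6) \<le> liminf (\<lambda>n. ennreal (norm (W n (t, x)) ^ 6))"
      using lim
    proof (rule eventually_mono, elim eventually_mono)
      fix t x assume "(\<lambda>n. W n (t, x)) \<longlonglongrightarrow> U (t, x)"
      then have "(\<lambda>n. ennreal (norm (W n (t, x)) ^ 6)) \<longlonglongrightarrow> ennreal (norm (U (t, x)) ^ 6)"
        by (intro tendsto_intros)
      then have "liminf (\<lambda>n. ennreal (norm (W n (t, x)) ^ 6)) = ennreal (norm (U (t, x)) ^ 6)"
        by (intro lim_imp_Liminf) simp
      then show "ennreal (norm (U (t, x)) ^ 6) \<le> liminf (\<lambda>n. ennreal (norm (W n (t, x)) ^ 6))" by simp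
    qed
  qed measurable
  also have "\<dots> \<le> liminf (\<lambda>n. L6pow (W n))"
    unfolding L6pow_def by (rule nn_integral_liminf) measurable
  also have "\<dots> \<le> liminf (\<lambda>n. B)"
    by (rule Liminf_mono[OF le])
  also have "\<dots> = B" by (simp add: Liminf_const)
  finally show ?thesis .
qed

text \<open>
The function at \<open>(t, x)\<close> that evolves under the Fourier multiplier \<open>m t\<close> from data with spectrum \<open>h\<close>.
\<close>

definition evolution :: "(real \<Rightarrow> real \<Rightarrow> complex) \<Rightarrow> (real \<Rightarrow> complex) \<Rightarrow> real \<times> real \<Rightarrow> complex" where
  "evolution m h = (\<lambda>(t, x). inv_fourier (\<lambda>\<xi>. m t \<xi> * h \<xi>) x)"

lemma borel_measurable_evolution:
  assumes m: "case_prod m \<in> borel_measurable borel" and [measurable]: "h \<in> borel_measurable borel"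
  shows "evolution m h \<in> borel_measurable borel"
proof -
  have [measurable]: "case_prod m \<in> borel_measurable (borel \<Otimes>\<^sub>M borel)"
    using m by (simp add: borel_prod)
  have "evolution m h \<in> borel_measurable (borel \<Otimes>\<^sub>M borel)"
    unfolding evolution_def inv_fourier_def fourier_def by measurable
  then show ?thesis by (simp add: borel_prod)
qed

lemma inv_fourier_cmult: "inv_fourier (\<lambda>\<xi>. c * f \<xi>) x = c * inv_fourier f x"
  unfolding inv_fourier_def fourier_def
  by (simp add: mult.left_commute[of _ c])

definition airy_symbol :: "real \<Rightarrow> real \<Rightarrow> complex" where
  "airy_symbol t \<xi> = complex_of_real (\<bar>\<xi>\<bar> powr (1 / 6)) * cis (t * \<xi> ^ 3)"

definition schr_symbol :: "real \<Rightarrow> real \<Rightarrow> complex" where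
  "schr_symbol t \<xi> = cis (t * \<xi> ^ 2)"

lemma borel_measurable_airy_symbol: "case_prod airy_symbol \<in> borel_measurable borel"
  unfolding airy_symbol_def[abs_def] borel_prod[symmetric] by measurable

lemma borel_measurable_schr_symbol: "case_prod schr_symbol \<in> borel_measurable borel"
  unfolding schr_symbol_def[abs_def] borel_prod[symmetric] by measurable

lemma borel_measurable_airy_evolution:
  "band_limited R h \<Longrightarrow> evolution airy_symbol h \<in> borel_measurable borel"
  by (intro borel_measurable_evolution borel_measurable_airy_symbol) (rule band_limited_measurable)

text \<open>
Every jointly measurable representative of the solution agrees almost everywhere with the explicit
integral, so none has a smaller norm.
\<close>

lemma airy_norm_ge:
  assumes h: "band_limited R h"
  shows "Lp_norm 6 lborel (evolution airy_symbol h) \<le> airy_norm (inv_fourier h)"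
  unfolding airy_norm_def L6_tx_norm_def
proof (rule INF_greatest)
  fix U :: "real \<times> real \<Rightarrow> complex"
  assume "U \<in> {U. U \<in> borel_measurable lborel \<and> (AE t in lborel. is_frac_deriv (1 / 6) (airy_group t (inv_fourier h)) (\<lambda>x. U (t, x)))}"
  then have U: "U \<in> borel_measurable borel"
    and fd: "AE t in lborel. is_frac_deriv (1 / 6) (airy_group t (inv_fourier h)) (\<lambda>x. U (t, x))"
    by auto
  have eq: "AE t in lborel. AE x in lborel. U (t, x) = evolution airy_symbol h (t, x)"
    using fd
  proof eventually_elim
    fix t assume w: "is_frac_deriv (1 / 6) (airy_group t (inv_fourier h)) (\<lambda>x. U (t, x))"
    have th: "band_limited R (\<lambda>\<xi>. cis (t * \<xi> ^ 3) * h \<xi>)"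
      by (rule band_limited_mult[OF h, where B=1]) auto
    show "AE x in lborel. U (t, x) = evolution airy_symbol h (t, x)"
      using is_frac_deriv_unique[OF w _ fourier_L2_airy_group(1,2)[OF h] th fourier_L2_airy_group(3)[OF h]]
      by (simp add: evolution_def airy_symbol_def mult.assoc)
  qed
  have "L6pow (evolution airy_symbol h) \<le> L6pow U"
    by (rule L6pow_mono_AE[OF borel_measurable_airy_evolution[OF h] U])
       (use eq in eventually_elim, erule eventually_mono, simp)
  then show "Lp_norm 6 lborel (evolution airy_symbol h) \<le> Lp_norm 6 lborel U"
    unfolding Lp_norm_6_le_iff Lp_norm_6_power .
qed

section \<open>Airy bounds for band-limited data\<close>

text \<open>
The suprema range over data of norm exactly 1. Data of smaller norm are scaled up; if the norm is
0, then the spectrum vanishes almost everywhere by the bound for the Fourier transform, and there is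
nothing to scale.
\<close>

lemma airy_bound_if_normalized:
  assumes h: "band_limited R h" and le: "L2sq (inv_fourier h) \<le> 1"
    and unit: "\<And>c. c > 0 \<Longrightarrow> L2sq (inv_fourier (\<lambda>\<xi>. complex_of_real c * h \<xi>)) = 1 \<Longrightarrow>
        L6pow (evolution airy_symbol (\<lambda>\<xi>. complex_of_real c * h \<xi>)) \<le> B"
  shows "L6pow (evolution airy_symbol h) \<le> B"
proof (cases "L2sq (inv_fourier h) = 0")
  case True
  have [measurable]: "h \<in> borel_measurable borel" using h by (rule band_limited_measurable)
  have "L2sq h = L2sq (fourier_L2 (inv_fourier h))"
    by (rule L2sq_cong_AE[symmetric, OF fourier_L2_inv_fourier[OF h]])
  also have "\<dots> \<le> ennreal (2 * pi) * L2sq (inv_fourier h)"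
    using L2sq_inv_fourier_finite[OF h] by (intro L2sq_fourier_L2_le) auto
  finally have "L2sq h = 0" using True by simp
  then have h0: "AE \<xi> in lborel. h \<xi> = 0"
    unfolding L2sq_def by (subst (asm) nn_integral_0_iff_AE) auto
  have "evolution airy_symbol h p = 0" for p
  proof -
    have "fourier (\<lambda>\<xi>. airy_symbol (fst p) \<xi> * h \<xi>) y = fourier (\<lambda>\<xi>. 0) y" for y
      by (rule fourier_cong_AE) (auto simp: airy_symbol_def intro: eventually_mono[OF h0])
    from this[of "- snd p"] show ?thesis by (simp add: evolution_def inv_fourier_def split_def fourier_def)
  qed
  then show ?thesis by (simp add: L6pow_def)
next
  case False
  define a where "a = enn2real (L2sq (inv_fourier h))"
  have fin: "L2sq (inv_fourier h) < top" using le by (simp add: order.strict_trans1)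
  then have a: "L2sq (inv_fourier h) = ennreal a" by (simp add: a_def)
  have "a \<ge> 0" by (simp add: a_def)
  moreover have "a \<noteq> 0" using False unfolding a by auto
  ultimately have a1: "0 < a" "a \<le> 1" using le unfolding a by (auto simp: ennreal_le_1)
  define c where "c = 1 / sqrt a"
  have c: "c \<ge> 1" "c\<^sup>2 * a = 1" using a1 by (auto simp: c_def power_divide)
  have "L2sq (inv_fourier (\<lambda>\<xi>. complex_of_real c * h \<xi>)) = ennreal (norm (complex_of_real c) ^ 2) * L2sq (inv_fourier h)"
    unfolding inv_fourier_cmult[abs_def] using h by (intro L2sq_cmult borel_measurable_inv_fourier band_limited_measurable)
  also have "\<dots> = 1" unfolding a using c a1 by (simp flip: ennreal_mult)
  finally have "L6pow (evolution airy_symbol (\<lambda>\<xi>. complex_of_real c * h \<xi>)) \<le> B"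
    using c by (intro unit) auto
  moreover have "L6pow (evolution airy_symbol h) \<le> L6pow (evolution airy_symbol (\<lambda>\<xi>. complex_of_real c * h \<xi>))"
    unfolding L6pow_def
  proof (intro nn_integral_mono ennreal_leI power_mono)
    fix p
    have "evolution airy_symbol (\<lambda>\<xi>. complex_of_real c * h \<xi>) p = complex_of_real c * evolution airy_symbol h p"
      unfolding evolution_def mult.left_commute[of _ "complex_of_real c"] by (simp add: inv_fourier_cmult split_def)
    moreover have "norm (evolution airy_symbol h p) \<le> c * norm (evolution airy_symbol h p)"
      using mult_right_mono[OF c(1) norm_ge_zero] by simp
    ultimately show "norm (evolution airy_symbol h p) \<le> norm (evolution airy_symbol (\<lambda>\<xi>. complex_of_real c * h \<xi>) p)"
      using c by (simp add: norm_mult)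
  qed simp
  ultimately show ?thesis by (rule order_trans[rotated])
qed

lemma band_limited_cmult: "band_limited R h \<Longrightarrow> band_limited R (\<lambda>\<xi>. c * h \<xi>)"
  by (rule band_limited_mult[where B="norm c"]) auto

lemma Lp_norm_2_eq_1: "L2sq u = 1 \<Longrightarrow> Lp_norm 2 lborel u = 1"
  using ennreal_power_le_iff[of 2 "Lp_norm 2 lborel u" 1] ennreal_power_le_iff[of 2 1 "Lp_norm 2 lborel u"]
  unfolding Lp_norm_2_power by (intro antisym) auto

lemma airy_complex_bound:
  assumes h: "band_limited R h" and le: "L2sq (inv_fourier h) \<le> 1"
  shows "L6pow (evolution airy_symbol h) \<le> S_airy_complex ^ 6"
proof (rule airy_bound_if_normalized[OF h le])
  fix c :: real assume 1: "L2sq (inv_fourier (\<lambda>\<xi>. complex_of_real c * h \<xi>)) = 1"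
  let ?h = "\<lambda>\<xi>. complex_of_real c * h \<xi>"
  have h': "band_limited R ?h" by (rule band_limited_cmult[OF h])
  have "Lp_norm 6 lborel (evolution airy_symbol ?h) \<le> airy_norm (inv_fourier ?h)"
    by (rule airy_norm_ge[OF h'])
  also have "\<dots> \<le> S_airy_complex"
    unfolding S_airy_complex_def
    using borel_measurable_inv_fourier[OF band_limited_measurable[OF h']] Lp_norm_2_eq_1[OF 1]
    by (intro SUP_upper) auto
  finally show "L6pow (evolution airy_symbol ?h) \<le> S_airy_complex ^ 6"
    unfolding Lp_norm_6_le_iff .
qed

lemma airy_real_bound:
  assumes h: "band_limited R h" and le: "L2sq (inv_fourier h) \<le> 1"
    and real: "\<And>x. Im (inv_fourier h x) = 0"
  shows "L6pow (evolution airy_symbol h) \<le> S_airy_real ^ 6"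
proof (rule airy_bound_if_normalized[OF h le])
  fix c :: real assume 1: "L2sq (inv_fourier (\<lambda>\<xi>. complex_of_real c * h \<xi>)) = 1"
  let ?h = "\<lambda>\<xi>. complex_of_real c * h \<xi>"
  have h': "band_limited R ?h" by (rule band_limited_cmult[OF h])
  define u where "u x = Re (inv_fourier ?h x)" for x
  have u: "inv_fourier ?h = (\<lambda>x. complex_of_real (u x))"
    by (simp add: fun_eq_iff complex_eq_iff u_def inv_fourier_cmult real)
  have [measurable]: "inv_fourier ?h \<in> borel_measurable borel"
    by (rule borel_measurable_inv_fourier[OF band_limited_measurable[OF h']])
  have "u \<in> borel_measurable lborel" unfolding u_def by measurable
  moreover have "Lp_norm 2 lborel u = 1"
    using Lp_norm_2_eq_1[OF 1] unfolding u by (simp add: Lp_norm_def)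
  ultimately have "airy_norm (\<lambda>x. complex_of_real (u x)) \<le> S_airy_real"
    unfolding S_airy_real_def by (intro SUP_upper) auto
  then have "Lp_norm 6 lborel (evolution airy_symbol ?h) \<le> S_airy_real"
    using airy_norm_ge[OF h'] unfolding u by (rule order_trans[rotated])
  then show "L6pow (evolution airy_symbol ?h) \<le> S_airy_real ^ 6"
    unfolding Lp_norm_6_le_iff .
qed

text \<open>
On the Fourier side this is taking the real part.
\<close>

definition hermitian_part :: "(real \<Rightarrow> complex) \<Rightarrow> real \<Rightarrow> complex" where
  "hermitian_part h \<xi> = (h \<xi> + cnj (h (- \<xi>))) / 2"

lemma inv_fourier_add:
  assumes "integrable lborel f" "integrable lborel g"
  shows "inv_fourier (\<lambda>\<xi>. f \<xi> + g \<xi>) x = inv_fourier f x + inv_fourier g x"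
  unfolding inv_fourier_def fourier_def distrib_left
  using assms by (subst Bochner_Integration.integral_add) (auto intro!: integrable_cis_mult simp: distrib_left)

lemma inv_fourier_cnj_reflect: "inv_fourier (\<lambda>\<xi>. cnj (f (- \<xi>))) x = cnj (inv_fourier f x)"
proof -
  have "fourier (\<lambda>\<xi>. cnj (f (- \<xi>))) (- x) = fourier (\<lambda>\<xi>. cnj (f \<xi>)) x"
    using fourier_reflect[of "\<lambda>\<xi>. cnj (f \<xi>)" "- x"] by simp
  also have "\<dots> = (LINT \<xi>|lborel. cnj (cis (- (\<xi> * (- x))) * f \<xi>))"
    unfolding fourier_def by (simp add: cis_cnj)
  also have "\<dots> = cnj (fourier f (- x))"
    unfolding fourier_def by (rule Bochner_Integration.integral_cnj)
  finally show ?thesis by (simp add: inv_fourier_def)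
qed

lemma inv_fourier_hermitian_part:
  assumes f: "integrable lborel f"
  shows "inv_fourier (hermitian_part f) x = complex_of_real (Re (inv_fourier f x))"
proof -
  have r: "integrable lborel (\<lambda>\<xi>. cnj (f (- \<xi>)))"
    using lborel_integrable_real_affine[OF f, of "- 1" 0] by simp
  have "hermitian_part f = (\<lambda>\<xi>. (1 / 2) * (f \<xi> + cnj (f (- \<xi>))))"
    by (simp add: hermitian_part_def fun_eq_iff)
  then have "inv_fourier (hermitian_part f) x = (1 / 2) * (inv_fourier f x + cnj (inv_fourier f x))"
    by (simp only: inv_fourier_cmult inv_fourier_add[OF f r] inv_fourier_cnj_reflect)
  then show ?thesis by (simp add: complex_add_cnj)
qed

lemma band_limited_hermitian_part:
  assumes h: "band_limited R h"
  shows "band_limited R (hermitian_part h)"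
proof -
  have [measurable]: "h \<in> borel_measurable borel" using h by (rule band_limited_measurable)
  have "L2sq (hermitian_part h) = L2sq (\<lambda>\<xi>. (1 / 2) * (h \<xi> - (- cnj (h (- \<xi>)))))"
    by (simp add: hermitian_part_def[abs_def])
  also have "\<dots> = ennreal (norm (1 / 2 :: complex) ^ 2) * L2sq (\<lambda>\<xi>. h \<xi> - (- cnj (h (- \<xi>))))"
    by (rule L2sq_cmult) measurable
  also have "L2sq (\<lambda>\<xi>. h \<xi> - (- cnj (h (- \<xi>)))) \<le> 2 * (L2sq (\<lambda>\<xi>. h \<xi> - 0) + L2sq (\<lambda>\<xi>. 0 - (- cnj (h (- \<xi>)))))"
    by (rule L2sq_diff_le) measurable
  also have "L2sq (\<lambda>\<xi>. 0 - (- cnj (h (- \<xi>)))) = L2sq h"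
    using L2sq_reflect[of h] by (simp add: L2sq_def)
  finally have "L2sq (hermitian_part h) \<le> ennreal (norm (1 / 2 :: complex) ^ 2) * (2 * (L2sq (\<lambda>\<xi>. h \<xi> - 0) + L2sq h))"
    by (simp add: mult_left_mono)
  also have "\<dots> < \<infinity>" using h by (simp add: band_limited_def ennreal_mult_less_top)
  finally show ?thesis using h by (simp add: band_limited_def hermitian_part_def[abs_def])
qed

text \<open>
The Airy symbol is Hermitian: \<open>\<xi>\<^sup>3\<close> is odd and \<open>\<bar>\<xi>\<bar>\<close> is even. Hence the flow preserves real-valued data.
\<close>

lemma evolution_airy_hermitian_part:
  assumes h: "band_limited R h"
  shows "evolution airy_symbol (hermitian_part h) p = complex_of_real (Re (evolution airy_symbol h p))"
proof -
  have [measurable]: "h \<in> borel_measurable borel" using h by (rule band_limited_measurable)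
  obtain t x where p: "p = (t, x)" by (cases p)
  have "band_limited R (\<lambda>\<xi>. airy_symbol t \<xi> * h \<xi>)"
    by (rule band_limited_mult[OF h, where B="R powr (1 / 6)"])
       (auto simp: airy_symbol_def norm_mult intro!: powr_mono2)
  then have i: "integrable lborel (\<lambda>\<xi>. airy_symbol t \<xi> * h \<xi>)" by (rule band_limited_integrable)
  have "airy_symbol t \<xi> * hermitian_part h \<xi> = hermitian_part (\<lambda>\<xi>. airy_symbol t \<xi> * h \<xi>) \<xi>" for \<xi>
    by (simp add: airy_symbol_def hermitian_part_def cis_cnj distrib_left)
  then show ?thesis
    using inv_fourier_hermitian_part[OF i, of x] by (simp add: p evolution_def)
qed

lemma airy_real_part_bound:
  assumes h: "band_limited R h" and le: "L2sq (inv_fourier h) \<le> 1"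
  shows "(\<integral>\<^sup>+ p. ennreal (\<bar>Re (evolution airy_symbol h p)\<bar> ^ 6) \<partial>lborel) \<le> S_airy_real ^ 6"
proof -
  have r: "inv_fourier (hermitian_part h) x = complex_of_real (Re (inv_fourier h x))" for x
    by (rule inv_fourier_hermitian_part[OF band_limited_integrable[OF h]])
  have "L2sq (inv_fourier (hermitian_part h)) \<le> L2sq (inv_fourier h)"
    by (rule L2sq_mono) (simp add: r abs_Re_le_cmod)
  also note le
  finally have "L6pow (evolution airy_symbol (hermitian_part h)) \<le> S_airy_real ^ 6"
    by (intro airy_real_bound[OF band_limited_hermitian_part[OF h]]) (simp_all add: r)
  then show ?thesis by (simp add: L6pow_def evolution_airy_hermitian_part[OF h])
qed

text \<open>
The imaginary part of a solution is the real part of \<open>-\<i>\<close> times it. Each part comes from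
data of norm at most 1, and \<open>\<bar>z\<bar>\<^sup>6 \<le> 4 (\<bar>Re z\<bar>\<^sup>6 + \<bar>Im z\<bar>\<^sup>6)\<close> yields \<open>4 * 2 = 8\<close>.
\<close>

lemma airy_complex_bound_by_real:
  assumes h: "band_limited R h" and le: "L2sq (inv_fourier h) \<le> 1"
  shows "L6pow (evolution airy_symbol h) \<le> 8 * S_airy_real ^ 6"
proof -
  let ?E = "evolution airy_symbol h"
  have [measurable]: "?E \<in> borel_measurable borel" by (rule borel_measurable_airy_evolution[OF h])
  let ?h = "\<lambda>\<xi>. - \<i> * h \<xi>"
  have rot: "evolution airy_symbol ?h p = - \<i> * ?E p" for p
    unfolding evolution_def mult.left_commute[of _ "- \<i>"] by (simp only: inv_fourier_cmult split_def)
  have "L2sq (inv_fourier ?h) \<le> 1"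
    using le by (simp only: inv_fourier_cmult[abs_def]) (simp add: L2sq_def norm_mult)
  from airy_real_part_bound[OF band_limited_cmult[OF h] this]
  have im: "(\<integral>\<^sup>+ p. ennreal (\<bar>Im (?E p)\<bar> ^ 6) \<partial>lborel) \<le> S_airy_real ^ 6"
    unfolding rot by simp
  have "norm z ^ 6 \<le> 4 * (\<bar>Re z\<bar> ^ 6 + \<bar>Im z\<bar> ^ 6)" for z
  proof -
    define a b where "a = (Re z)\<^sup>2" and "b = (Im z)\<^sup>2"
    have ab: "0 \<le> a" "0 \<le> b" by (simp_all add: a_def b_def)
    have "norm z ^ 6 = (norm z ^ 2) ^ 3" by (simp flip: power_mult)
    also have "\<dots> = (a + b) ^ 3" by (simp add: cmod_power2 a_def b_def)
    also have "\<dots> = 4 * (a ^ 3 + b ^ 3) - 3 * (a + b) * (a - b)\<^sup>2"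
      by (simp add: power2_eq_square power3_eq_cube algebra_simps)
    also have "\<dots> \<le> 4 * (a ^ 3 + b ^ 3)" using ab by simp
    also have "a ^ 3 = \<bar>Re z\<bar> ^ 6"
      by (simp add: a_def power_even_abs flip: power_mult)
    also have "b ^ 3 = \<bar>Im z\<bar> ^ 6"
      by (simp add: b_def power_even_abs flip: power_mult)
    finally show ?thesis .
  qed
  then have "L6pow ?E \<le> (\<integral>\<^sup>+ p. 4 * (ennreal (\<bar>Re (?E p)\<bar> ^ 6) + ennreal (\<bar>Im (?E p)\<bar> ^ 6)) \<partial>lborel)"
    unfolding L6pow_def by (intro nn_integral_mono) (simp flip: ennreal_plus ennreal_mult ennreal_numeral)
  also have "\<dots> = 4 * ((\<integral>\<^sup>+ p. ennreal (\<bar>Re (?E p)\<bar> ^ 6) \<partial>lborel) + (\<integral>\<^sup>+ p. ennreal (\<bar>Im (?E p)\<bar> ^ 6) \<partial>lborel))"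
    by (simp add: nn_integral_cmult nn_integral_add)
  also have "\<dots> \<le> 4 * (S_airy_real ^ 6 + S_airy_real ^ 6)"
    by (intro mult_left_mono add_mono airy_real_part_bound[OF h le] im) simp
  also have "\<dots> = 8 * S_airy_real ^ 6"
    by (simp flip: mult_2 mult.assoc)
  finally show ?thesis .
qed

section \<open>From the Airy flow to the Schroedinger flow\<close>

text \<open>
The Airy symbol around the frequency \<open>N\<close>, in the moving and rescaled coordinates and without the
factor \<open>N powr (1/6)\<close>. It tends to \<open>schr_symbol\<close> as \<open>N\<close> tends to infinity.
\<close>

definition modulated_symbol :: "real \<Rightarrow> real \<Rightarrow> real \<Rightarrow> complex" where
  "modulated_symbol N s \<eta> = complex_of_real (\<bar>1 + \<eta> / N\<bar> powr (1 / 6)) * cis (s * \<eta>\<^sup>2 + s * \<eta> ^ 3 / (3 * N))"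

lemma borel_measurable_modulated_symbol: "case_prod (modulated_symbol N) \<in> borel_measurable borel"
  unfolding modulated_symbol_def[abs_def] borel_prod[symmetric] by measurable

lemma airy_evolution_shifted:
  assumes N: "N > 0"
  shows "evolution airy_symbol (\<lambda>\<xi>. h (\<xi> - N)) (t, x) =
    cis (x * N + t * N ^ 3) * complex_of_real (N powr (1 / 6)) *
      evolution (modulated_symbol N) h (3 * N * t, 3 * t * N\<^sup>2 + x)"
proof -
  let ?y = "3 * t * N\<^sup>2 + x"
  have pt: "cis (- ((N + 1 * \<eta>) * - x)) * (airy_symbol t (N + 1 * \<eta>) * h (N + 1 * \<eta> - N)) =
     cis (x * N + t * N ^ 3) * complex_of_real (N powr (1 / 6)) *
      (cis (- (\<eta> * - ?y)) * (modulated_symbol N (3 * N * t) \<eta> * h \<eta>))" for \<eta>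
  proof -
    have "N + \<eta> = N * (1 + \<eta> / N)" using N by (simp add: distrib_left)
    then have "\<bar>N + \<eta>\<bar> = N * \<bar>1 + \<eta> / N\<bar>"
      using N by (simp only: abs_mult abs_of_pos)
    then have a: "\<bar>N + \<eta>\<bar> powr (1 / 6) = N powr (1 / 6) * \<bar>1 + \<eta> / N\<bar> powr (1 / 6)"
      using N by (simp add: powr_mult)
    have "(N + \<eta>) * x + t * (N + \<eta>) ^ 3 = (x * N + t * N ^ 3) + (\<eta> * ?y + ((3 * N * t) * \<eta>\<^sup>2 + (3 * N * t) * \<eta> ^ 3 / (3 * N)))"
      using N by (simp add: power2_eq_square power3_eq_cube algebra_simps)
    then have b: "cis ((N + \<eta>) * x) * cis (t * (N + \<eta>) ^ 3) = cis (x * N + t * N ^ 3) * (cis (\<eta> * ?y) * cis ((3 * N * t) * \<eta>\<^sup>2 + (3 * N * t) * \<eta> ^ 3 / (3 * N)))"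
      unfolding cis_mult by simp
    have "cis (- ((N + 1 * \<eta>) * - x)) * (airy_symbol t (N + 1 * \<eta>) * h (N + 1 * \<eta> - N)) =
      (cis ((N + \<eta>) * x) * cis (t * (N + \<eta>) ^ 3)) * complex_of_real (\<bar>N + \<eta>\<bar> powr (1 / 6)) * h \<eta>"
      by (simp add: airy_symbol_def mult_ac)
    also have "\<dots> = cis (x * N + t * N ^ 3) * complex_of_real (N powr (1 / 6)) *
      (cis (- (\<eta> * - ?y)) * (modulated_symbol N (3 * N * t) \<eta> * h \<eta>))"
      unfolding a b modulated_symbol_def by (simp only: of_real_mult mult_ac mult_minus_right minus_minus)
    finally show ?thesis .
  qed
  have "fourier (\<lambda>\<xi>. airy_symbol t \<xi> * h (\<xi> - N)) (- x) =
    \<bar>1\<bar> *\<^sub>R (LINT \<eta>|lborel. cis (- ((N + 1 * \<eta>) * - x)) * (airy_symbol t (N + 1 * \<eta>) * h (N + 1 * \<eta> - N)))"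
    unfolding fourier_def by (rule lborel_integral_real_affine) simp
  also have "\<dots> = cis (x * N + t * N ^ 3) * complex_of_real (N powr (1 / 6)) *
      fourier (\<lambda>\<eta>. modulated_symbol N (3 * N * t) \<eta> * h \<eta>) (- ?y)"
    unfolding pt integral_mult_right_zero fourier_def[symmetric] by simp
  finally show ?thesis
    by (simp add: evolution_def inv_fourier_def)
qed

text \<open>
For fixed \<open>t\<close> the change of position is a translation; the change of time has Jacobian \<open>3 N\<close>, of which
the amplitude \<open>(N powr (1/6)) ^ 6\<close> accounts for \<open>N\<close>.
\<close>

lemma L6pow_modulated:
  assumes N: "N > 0" and [measurable]: "h \<in> borel_measurable borel"
  shows "L6pow (evolution (modulated_symbol N) h) = 3 * L6pow (evolution airy_symbol (\<lambda>\<xi>. h (\<xi> - N)))"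
proof -
  define V where "V = evolution (modulated_symbol N) h"
  have V[measurable]: "V \<in> borel_measurable borel"
    unfolding V_def by (intro borel_measurable_evolution borel_measurable_modulated_symbol) measurable
  have A[measurable]: "evolution airy_symbol (\<lambda>\<xi>. h (\<xi> - N)) \<in> borel_measurable borel"
    by (intro borel_measurable_evolution borel_measurable_airy_symbol) measurable
  have [measurable]: "V \<in> borel_measurable (borel \<Otimes>\<^sub>M borel)" using V by (simp add: borel_prod)
  define \<Phi> where "\<Phi> s = (\<integral>\<^sup>+ y. ennreal (norm (V (s, y)) ^ 6) \<partial>lborel)" for s
  have [measurable]: "\<Phi> \<in> borel_measurable borel" unfolding \<Phi>_def by measurable
  have pw: "ennreal (norm (evolution airy_symbol (\<lambda>\<xi>. h (\<xi> - N)) (t, x)) ^ 6)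
      = ennreal N * ennreal (norm (V (3 * N * t, 3 * t * N\<^sup>2 + 1 * x)) ^ 6)" for t x
  proof -
    have "(N powr (1 / 6)) ^ 6 = N"
      using N by (simp add: powr_power)
    then show ?thesis
      using N unfolding airy_evolution_shifted[OF N] V_def[symmetric]
      by (simp add: norm_mult power_mult_distrib ennreal_mult)
  qed
  have "L6pow (evolution airy_symbol (\<lambda>\<xi>. h (\<xi> - N)))
     = (\<integral>\<^sup>+ t. \<integral>\<^sup>+ x. ennreal N * ennreal (norm (V (3 * N * t, 3 * t * N\<^sup>2 + 1 * x)) ^ 6) \<partial>lborel \<partial>lborel)"
    unfolding L6pow_def by (subst nn_integral_lborel_iterated) (simp_all only: pw, measurable)
  also have "\<dots> = (\<integral>\<^sup>+ t. ennreal N * \<Phi> (3 * N * t) \<partial>lborel)"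
  proof (rule nn_integral_cong)
    fix t
    have "\<Phi> (3 * N * t) = ennreal \<bar>1\<bar> * (\<integral>\<^sup>+ x. ennreal (norm (V (3 * N * t, 3 * t * N\<^sup>2 + 1 * x)) ^ 6) \<partial>lborel)"
      unfolding \<Phi>_def by (rule nn_integral_real_affine) auto
    then show "(\<integral>\<^sup>+ x. ennreal N * ennreal (norm (V (3 * N * t, 3 * t * N\<^sup>2 + 1 * x)) ^ 6) \<partial>lborel) = ennreal N * \<Phi> (3 * N * t)"
      by (subst nn_integral_cmult) auto
  qed
  also have "\<dots> = ennreal N * (\<integral>\<^sup>+ t. \<Phi> (0 + 3 * N * t) \<partial>lborel)"
    by (subst nn_integral_cmult) auto
  finally have "3 * L6pow (evolution airy_symbol (\<lambda>\<xi>. h (\<xi> - N))) = ennreal \<bar>3 * N\<bar> * (\<integral>\<^sup>+ t. \<Phi> (0 + 3 * N * t) \<partial>lborel)"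
    using N by (simp add: ennreal_mult mult.assoc)
  also have "\<dots> = (\<integral>\<^sup>+ s. \<Phi> s \<partial>lborel)"
    by (rule nn_integral_real_affine[symmetric]) (use N in auto)
  also have "\<dots> = L6pow V"
    unfolding L6pow_def \<Phi>_def by (rule nn_integral_lborel_iterated[symmetric]) measurable
  finally show ?thesis unfolding V_def ..
qed

lemma modulated_evolution_tendsto:
  assumes h: "band_limited R h"
  shows "(\<lambda>n. evolution (modulated_symbol (real (Suc n))) h (s, y)) \<longlonglongrightarrow> evolution schr_symbol h (s, y)"
proof -
  have [measurable]: "h \<in> borel_measurable borel" using h by (rule band_limited_measurable)
  let ?B = "(1 + \<bar>R\<bar>) powr (1 / 6)"
  have "(\<lambda>n. fourier (\<lambda>\<eta>. modulated_symbol (real (Suc n)) s \<eta> * h \<eta>) (- y)) \<longlonglongrightarrow> fourier (\<lambda>\<eta>. schr_symbol s \<eta> * h \<eta>) (- y)"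
    unfolding fourier_def
  proof (rule integral_dominated_convergence[where w="\<lambda>\<eta>. ?B * norm (h \<eta>)"])
    show "(\<lambda>x. cis (- (x * - y)) * (schr_symbol s x * h x)) \<in> borel_measurable lborel"
      unfolding schr_symbol_def by measurable
    show "(\<lambda>x. cis (- (x * - y)) * (modulated_symbol (real (Suc n)) s x * h x)) \<in> borel_measurable lborel" for n
      unfolding modulated_symbol_def by measurable
    show "integrable lborel (\<lambda>\<eta>. ?B * norm (h \<eta>))"
      using band_limited_integrable[OF h] by simp
    show "AE \<eta> in lborel. (\<lambda>n. cis (- (\<eta> * - y)) * (modulated_symbol (real (Suc n)) s \<eta> * h \<eta>))
        \<longlonglongrightarrow> cis (- (\<eta> * - y)) * (schr_symbol s \<eta> * h \<eta>)"
    proof (intro AE_I2)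
      fix \<eta> :: real
      have l: "(\<lambda>n. 1 / real (Suc n)) \<longlonglongrightarrow> 0" by (intro LIMSEQ_Suc lim_1_over_n)
      have "(\<lambda>n. \<bar>1 + \<eta> * (1 / real (Suc n))\<bar> powr (1 / 6)) \<longlonglongrightarrow> \<bar>1 + \<eta> * 0\<bar> powr (1 / 6)"
        by (intro tendsto_intros l) auto
      moreover have "(\<lambda>n. cis (s * \<eta>\<^sup>2 + s * \<eta> ^ 3 / 3 * (1 / real (Suc n)))) \<longlonglongrightarrow> cis (s * \<eta>\<^sup>2 + s * \<eta> ^ 3 / 3 * 0)"
        by (intro tendsto_intros l)
      ultimately have "(\<lambda>n. modulated_symbol (real (Suc n)) s \<eta>) \<longlonglongrightarrow> complex_of_real 1 * cis (s * \<eta>\<^sup>2)"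
        unfolding modulated_symbol_def by (intro tendsto_mult tendsto_of_real) (simp_all del: of_nat_Suc)
      then show "(\<lambda>n. cis (- (\<eta> * - y)) * (modulated_symbol (real (Suc n)) s \<eta> * h \<eta>))
        \<longlonglongrightarrow> cis (- (\<eta> * - y)) * (schr_symbol s \<eta> * h \<eta>)"
        unfolding schr_symbol_def by (intro tendsto_mult tendsto_const) simp
    qed
    show "AE \<eta> in lborel. norm (cis (- (\<eta> * - y)) * (modulated_symbol (real (Suc n)) s \<eta> * h \<eta>)) \<le> ?B * norm (h \<eta>)" for n
    proof (intro AE_I2)
      fix \<eta>
      show "norm (cis (- (\<eta> * - y)) * (modulated_symbol (real (Suc n)) s \<eta> * h \<eta>)) \<le> ?B * norm (h \<eta>)"
      proof (cases "\<bar>\<eta>\<bar> \<le> R")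
        case True
        \<comment> \<open>since \<open>N \<ge> 1\<close>, the weight is bounded uniformly in \<open>N\<close> on the band\<close>
        have "\<bar>\<eta> / real (Suc n)\<bar> \<le> \<bar>\<eta>\<bar>"
          using mult_left_mono[of 1 "real (Suc n)" "\<bar>\<eta>\<bar>"] by (simp add: abs_divide pos_divide_le_eq del: of_nat_Suc) 
        then have "\<bar>1 + \<eta> / real (Suc n)\<bar> \<le> 1 + \<bar>R\<bar>" using True by linarith
        then have "\<bar>1 + \<eta> / real (Suc n)\<bar> powr (1 / 6) \<le> ?B" by (intro powr_mono2) auto
        then show ?thesis
          by (simp add: modulated_symbol_def norm_mult mult_right_mono del: of_nat_Suc)
      next
        case False
        then show ?thesis using h by (simp add: band_limited_def)
      qed
    qed
  qed
  then show ?thesis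
    unfolding evolution_def inv_fourier_def prod.case by (intro tendsto_mult tendsto_const)
qed

lemma band_limited_shift:
  assumes h: "band_limited R h" and N: "N > 0"
  shows "band_limited (R + N) (\<lambda>\<xi>. h (\<xi> - N))" and "L2sq (\<lambda>\<xi>. h (\<xi> - N)) = L2sq h"
proof -
  have [measurable]: "h \<in> borel_measurable borel" using h by (rule band_limited_measurable)
  have "L2sq h = ennreal \<bar>1\<bar> * (\<integral>\<^sup>+ \<xi>. ennreal (norm (h (- N + 1 * \<xi>)) ^ 2) \<partial>lborel)"
    unfolding L2sq_def by (rule nn_integral_real_affine) auto
  then show eq: "L2sq (\<lambda>\<xi>. h (\<xi> - N)) = L2sq h" by (simp add: L2sq_def)
  have "R < \<bar>\<xi> - N\<bar>" if "R + N < \<bar>\<xi>\<bar>" for \<xi> using that N by linarith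
  then show "band_limited (R + N) (\<lambda>\<xi>. h (\<xi> - N))"
    using h unfolding band_limited_def eq by auto
qed

lemma schr_evolution_bound:
  assumes airy: "\<And>R h. band_limited R h \<Longrightarrow> L2sq (inv_fourier h) \<le> 1 \<Longrightarrow> L6pow (evolution airy_symbol h) \<le> B"
    and h: "band_limited R h" and le: "L2sq h \<le> ennreal (2 * pi)"
  shows "L6pow (evolution schr_symbol h) \<le> 3 * B"
proof (rule L6pow_fatou[where W="\<lambda>n. evolution (modulated_symbol (real (Suc n))) h"])
  have [measurable]: "h \<in> borel_measurable borel" using h by (rule band_limited_measurable)
  show "evolution (modulated_symbol (real (Suc n))) h \<in> borel_measurable borel" for n
    by (intro borel_measurable_evolution borel_measurable_modulated_symbol) measurable
  show "evolution schr_symbol h \<in> borel_measurable borel"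
    by (intro borel_measurable_evolution borel_measurable_schr_symbol) measurable
  show "AE t in lborel. AE x in lborel. (\<lambda>n. evolution (modulated_symbol (real (Suc n))) h (t, x)) \<longlonglongrightarrow> evolution schr_symbol h (t, x)"
    using modulated_evolution_tendsto[OF h] by simp
  show "\<forall>\<^sub>F n in sequentially. L6pow (evolution (modulated_symbol (real (Suc n))) h) \<le> 3 * B"
  proof (intro always_eventually allI)
    fix n
    let ?N = "real (Suc n)"
    have N: "?N > 0" by simp
    have sh: "band_limited (R + ?N) (\<lambda>\<xi>. h (\<xi> - ?N))" by (rule band_limited_shift(1)[OF h N])
    have "ennreal (2 * pi) * L2sq (inv_fourier (\<lambda>\<xi>. h (\<xi> - ?N))) \<le> ennreal (2 * pi) * 1"
      using L2sq_inv_fourier_le[OF band_limited_integrable[OF sh]] le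
      unfolding band_limited_shift(2)[OF h N] by simp
    then have "L2sq (inv_fourier (\<lambda>\<xi>. h (\<xi> - ?N))) \<le> 1"
      by (subst (asm) ennreal_mult_le_mult_iff) auto
    then have "L6pow (evolution airy_symbol (\<lambda>\<xi>. h (\<xi> - ?N))) \<le> B"
      by (rule airy[OF sh])
    then show "L6pow (evolution (modulated_symbol ?N) h) \<le> 3 * B"
      by (subst L6pow_modulated[OF N]) (auto intro: mult_left_mono)
  qed
qed

section \<open>Arbitrary data\<close>

lemma AE_lborel_reflect:
  fixes P :: "real \<Rightarrow> bool"
  assumes "AE x in lborel. P x"
  shows "AE x in lborel. P (- x)"
proof -
  obtain N where N: "N \<in> null_sets lborel" "{x \<in> space lborel. \<not> P x} \<subseteq> N"
    using assms unfolding eventually_ae_filter by blast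
  have "N \<in> sets borel" using N(1) by auto
  then have "Measurable.pred borel (\<lambda>x. x \<notin> N)" by measurable
  then have "AE x in lborel. 0 + (- 1) * x \<notin> N"
    using AE_not_in[OF N(1)] by (intro AE_borel_affine) auto
  then show ?thesis
  proof eventually_elim
    fix x assume "0 + (- 1) * x \<notin> N"
    then have "- x \<notin> N" by simp
    then show "P (- x)" using N(2) by auto
  qed
qed

text \<open>
The free evolutions \<open>g t\<close> of the spectrum all have the same modulus, so one sequence of cutoffs serves
every time. The pointwise limit \<open>U\<close> of the band-limited solutions is then a measurable function on
space-time whose time slices are the Schroedinger solution.
\<close>

lemma schr_norm_le:
  assumes airy: "\<And>R h. band_limited R h \<Longrightarrow> L2sq (inv_fourier h) \<le> 1 \<Longrightarrow> L6pow (evolution airy_symbol h) \<le> B"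
    and [measurable]: "u \<in> borel_measurable borel" and u: "L2sq u = 1"
    and D: "3 * B \<le> D ^ 6"
  shows "schr_norm u \<le> D"
proof -
  define v where "v = fourier_L2 u"
  have [measurable]: "v \<in> borel_measurable borel"
    using is_L2_limit_fourier_L2[of u] u by (simp add: v_def is_L2_limit_iff)
  have v_le: "L2sq v \<le> ennreal (2 * pi)"
    using L2sq_fourier_L2_le[of u] u by (simp add: v_def)
  then have v_fin: "L2sq v < \<infinity>" by (auto elim: order.strict_trans1)
  define g where "g t \<xi> = cis (t * \<xi> ^ 2) * v \<xi>" for t \<xi>
  have [measurable]: "g t \<in> borel_measurable borel" for t unfolding g_def by measurable
  have g_fin: "L2sq (g t) < \<infinity>" for t using v_fin by (simp add: L2sq_def g_def)
  obtain k where k: "\<And>n. L2sq (\<lambda>x. v x - cutoff (k n) v x) \<le> ennreal ((1 / 8) ^ n)"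
    using fast_cutoff_exists[OF _ v_fin] by auto
  have cut_g: "cutoff r (g t) \<xi> = cis (t * \<xi> ^ 2) * cutoff r v \<xi>" for r t \<xi>
    by (simp add: cutoff_def g_def)
  have gk: "L2sq (\<lambda>x. g t x - cutoff (k n) (g t) x) \<le> ennreal ((1 / 8) ^ n)" for t n
  proof -
    have "norm (g t x - cutoff (k n) (g t) x) = norm (v x - cutoff (k n) v x)" for x
      unfolding cut_g g_def by (simp flip: right_diff_distrib)
    then show ?thesis using k[of n] by (simp add: L2sq_def)
  qed
  define W where "W n = evolution schr_symbol (cutoff (k n) v)" for n
  have W_eq: "W n (t, x) = inv_fourier (cutoff (k n) (g t)) x" for n t x
    by (simp add: W_def evolution_def schr_symbol_def cut_g[abs_def])
  have Wm[measurable]: "W n \<in> borel_measurable borel" for n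
    unfolding W_def by (intro borel_measurable_evolution borel_measurable_schr_symbol) measurable
  define U where "U p = lim (\<lambda>n. W n p)" for p
  have Um: "U \<in> borel_measurable borel" unfolding U_def[abs_def] by measurable
  have lim: "AE x in lborel. (\<lambda>n. W n (t, x)) \<longlonglongrightarrow> complex_of_real (1 / (2 * pi)) * fourier_lim k (g t) (- x)" for t
  proof -
    have "AE x in lborel. (\<lambda>n. fourier (cutoff (k n) (g t)) (- x)) \<longlonglongrightarrow> fourier_lim k (g t) (- x)"
      by (rule AE_lborel_reflect[OF fourier_cutoff_tendsto[OF _ g_fin gk]]) measurable
    then show ?thesis
      unfolding W_eq inv_fourier_def by eventually_elim (intro tendsto_mult tendsto_const)
  qed
  have U_eq: "AE x in lborel. U (t, x) = complex_of_real (1 / (2 * pi)) * fourier_lim k (g t) (- x)" for t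
    using lim[of t] unfolding U_def by eventually_elim (rule limI)
  have schr: "AE x in lborel. U (t, x) = schrodinger_group t u x" for t
  proof -
    have "AE x in lborel. schrodinger_group t u x = complex_of_real (1 / (2 * pi)) * fourier_lim k (g t) (- x)"
      unfolding schrodinger_group_def v_def[symmetric] g_def[symmetric, abs_def]
      by (rule inv_fourier_L2_eq[OF _ is_L2_limit_inv_fourier_lim[OF _ g_fin gk]]) auto
    with U_eq[of t] show ?thesis by eventually_elim simp
  qed
  have "L6pow U \<le> 3 * B"
  proof (rule L6pow_fatou[OF Wm Um])
    show "AE t in lborel. AE x in lborel. (\<lambda>n. W n (t, x)) \<longlonglongrightarrow> U (t, x)"
    proof (rule AE_I2)
      fix t
      show "AE x in lborel. (\<lambda>n. W n (t, x)) \<longlonglongrightarrow> U (t, x)"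
        using lim[of t] U_eq[of t] by eventually_elim simp
    qed
    show "\<forall>\<^sub>F n in sequentially. L6pow (W n) \<le> 3 * B"
      unfolding W_def
    proof (intro always_eventually allI schr_evolution_bound[OF airy])
      fix n
      show "L2sq (cutoff (k n) v) \<le> ennreal (2 * pi)"
        by (rule order_trans[OF L2sq_cutoff_le v_le])
      then show "band_limited (k n) (cutoff (k n) v)"
        by (auto simp: band_limited_def cutoff_def indicator_def elim: order.strict_trans1)
    qed
  qed
  also note D
  finally have "Lp_norm 6 lborel U \<le> D" unfolding Lp_norm_6_le_iff .
  moreover have "schr_norm u \<le> Lp_norm 6 lborel U"
    unfolding schr_norm_def L6_tx_norm_def by (rule INF_lower) (use Um schr in auto)
  ultimately show ?thesis by (rule order_trans[rotated])
qed

lemma S_schr_complex_le: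
  assumes "\<And>R h. band_limited R h \<Longrightarrow> L2sq (inv_fourier h) \<le> 1 \<Longrightarrow> L6pow (evolution airy_symbol h) \<le> B"
    and "3 * B \<le> D ^ 6"
  shows "S_schr_complex \<le> D"
  unfolding S_schr_complex_def
proof (rule SUP_least)
  fix u :: "real \<Rightarrow> complex" assume "u \<in> {u. u \<in> borel_measurable lborel \<and> Lp_norm 2 lborel u = 1}"
  then have "u \<in> borel_measurable borel" "L2sq u = 1"
    by (auto simp flip: Lp_norm_2_power)
  then show "schr_norm u \<le> D" by (intro schr_norm_le[OF assms(1)] assms(2))
qed

theorem lemma6p1:
  shows "S_schr_complex \<le> ennreal (3 powr (1 / 6)) * S_airy_complex \<and>
         S_schr_complex \<le> ennreal (2 powr (1 / 2) * 3 powr (1 / 6)) * S_airy_real"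
proof
  have 3: "((3::real) powr (1 / 6)) ^ 6 = 3" by (simp add: powr_power)
  have 2: "((2::real) powr (1 / 2)) ^ 6 = 8" by (simp add: powr_power)
  show "S_schr_complex \<le> ennreal (3 powr (1 / 6)) * S_airy_complex"
  proof (rule S_schr_complex_le[OF airy_complex_bound])
    show "3 * S_airy_complex ^ 6 \<le> (ennreal (3 powr (1 / 6)) * S_airy_complex) ^ 6"
      by (simp add: power_mult_distrib ennreal_power 3)
  qed
  show "S_schr_complex \<le> ennreal (2 powr (1 / 2) * 3 powr (1 / 6)) * S_airy_real"
  proof (rule S_schr_complex_le[OF airy_complex_bound_by_real])
    have "(2 powr (1 / 2) * 3 powr (1 / 6) :: real) ^ 6 = 24"
      unfolding power_mult_distrib 2 3 by simp
    then show "3 * (8 * S_airy_real ^ 6) \<le> (ennreal (2 powr (1 / 2) * 3 powr (1 / 6)) * S_airy_real) ^ 6"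
      unfolding power_mult_distrib[of "ennreal _"] by (simp add: ennreal_power flip: mult.assoc)
  qed
qed

end
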